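(* Let $G$ be a finite group. The following are equivalent: (1) the set $\{\ker\chi : \chi\in\mathrm{Irr}(G),\ \chi(1)>1\}$ of kernels of the nonlinear irreducible characters of $G$ is totally ordered by inclusion; (2) for every normal subgroup $M$ of $G$ with $1\le M< G'$, either (a) $G'/M$ is not a chief factor of $G$ and $G/M$ has a unique minimal normal subgroup, or (b) $G'/M$ is a chief factor of $G$ and $G/M$ has at most two minimal normal subgroups.
   Context: All groups are finite. $\mathrm{Irr}(G)$ denotes the set of complex irreducible characters of $G$, $\ker\chi=\{g\in G:\chi(g)=\chi(1)\}$, and $G'$ is the derived subgroup. *)

theory Defs
  imports "HOL-Algebra.Algebra" "Jordan_Normal_Form.Matrix"
begin

definition is_rep :: "('a, 'b) monoid_scheme \<Rightarrow> nat \<Rightarrow> ('a \<Rightarrow> complex mat) \<Rightarrow> bool" where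
  "is_rep G n \<rho> \<longleftrightarrow>
     (\<forall>g\<in>carrier G. \<rho> g \<in> carrier_mat n n) \<and>
     (\<forall>g\<in>carrier G. \<forall>h\<in>carrier G. \<rho> (g \<otimes>\<^bsub>G\<^esub> h) = \<rho> g * \<rho> h) \<and>
     \<rho> \<one>\<^bsub>G\<^esub> = 1\<^sub>m n"

definition is_subspace :: "nat \<Rightarrow> complex vec set \<Rightarrow> bool" where
  "is_subspace n W \<longleftrightarrow> W \<subseteq> carrier_vec n \<and> 0\<^sub>v n \<in> W \<and>
     (\<forall>v\<in>W. \<forall>w\<in>W. v + w \<in> W) \<and> (\<forall>c. \<forall>v\<in>W. c \<cdot>\<^sub>v v \<in> W)"

definition irr_rep :: "('a, 'b) monoid_scheme \<Rightarrow> nat \<Rightarrow> ('a \<Rightarrow> complex mat) \<Rightarrow> bool" where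
  "irr_rep G n \<rho> \<longleftrightarrow> is_rep G n \<rho> \<and> n > 0 \<and>
     (\<forall>W. is_subspace n W \<and> (\<forall>g\<in>carrier G. \<forall>v\<in>W. \<rho> g *\<^sub>v v \<in> W)
          \<longrightarrow> W = {0\<^sub>v n} \<or> W = carrier_vec n)"

definition mat_trace :: "complex mat \<Rightarrow> complex" where
  "mat_trace A = (\<Sum>i<dim_row A. A $$ (i, i))"

definition Irr :: "('a, 'b) monoid_scheme \<Rightarrow> ('a \<Rightarrow> complex) set" where
  "Irr G = {\<chi>. \<exists>n \<rho>. irr_rep G n \<rho> \<and> \<chi> = (\<lambda>g\<in>carrier G. mat_trace (\<rho> g))}"

definition char_ker :: "('a, 'b) monoid_scheme \<Rightarrow> ('a \<Rightarrow> complex) \<Rightarrow> 'a set" where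
  "char_ker G \<chi> = {g \<in> carrier G. \<chi> g = \<chi> \<one>\<^bsub>G\<^esub>}"

definition chief_factor :: "('a, 'b) monoid_scheme \<Rightarrow> 'a set \<Rightarrow> 'a set \<Rightarrow> bool" where
  "chief_factor G H K \<longleftrightarrow> K \<lhd> G \<and> H \<lhd> G \<and> K \<subset> H \<and>
     \<not> (\<exists>N. N \<lhd> G \<and> K \<subset> N \<and> N \<subset> H)"

definition minimal_normal :: "('a, 'b) monoid_scheme \<Rightarrow> 'a set \<Rightarrow> bool" where
  "minimal_normal G N \<longleftrightarrow> N \<lhd> G \<and> N \<noteq> {\<one>\<^bsub>G\<^esub>} \<and>
     (\<forall>L. L \<lhd> G \<and> L \<subseteq> N \<longrightarrow> L = {\<one>\<^bsub>G\<^esub>} \<or> L = N)"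

end

theory Submission
  imports Defs "Jordan_Normal_Form.Spectral_Radius" "HOL-Library.Function_Algebras"
begin

text \<open>Both conditions say that the normal subgroups of \<open>G\<close> not containing \<open>G'\<close> form a chain.

  For (1): the kernel of a nonlinear irreducible character does not contain \<open>G'\<close>. Conversely, a normal
  subgroup \<open>N\<close> not containing \<open>G'\<close> is the intersection of the kernels of the nonlinear characters of
  \<open>G/N\<close>, hence itself such a kernel when these kernels form a chain.

  For (2): let \<open>K\<^sub>1\<close>, \<open>K\<^sub>2\<close> not contain \<open>G'\<close> and put \<open>M = K\<^sub>1 \<inter> K\<^sub>2 \<inter> G'\<close>. In case (a), unless \<open>M\<close> is one of
  the \<open>K\<^sub>i\<close>, the unique minimal normal subgroup of \<open>G/M\<close> would lie in \<open>M/M\<close>. In case (b), \<open>K\<^sub>i \<inter> G' = M\<close>, so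
  \<open>K\<^sub>i/M\<close> is central in \<open>G/M\<close>; the only minimal normal subgroup besides \<open>G'/M\<close> forces \<open>K\<^sub>1/M\<close> and
  \<open>K\<^sub>2/M\<close> to be \<open>p\<close>-groups for the same prime \<open>p\<close>. As there are at most \<open>p\<close> central solutions of \<open>x\<^sup>p = 1\<close>, there
  are at most \<open>p\<^sup>k\<close> of \<open>x\<^sup>q = 1\<close> for \<open>q = p\<^sup>k\<close>, and both subgroups are of the form \<open>{x. x\<^sup>q = 1}\<close>.\<close>

section \<open>Central subgroups of a group with two minimal normal subgroups\<close>

lemma (in group) mult_inv_cancel:
  assumes "a \<in> carrier G" "x \<in> carrier G"
  shows "a \<otimes> (inv a \<otimes> x) = x" "inv a \<otimes> (a \<otimes> x) = x"
  using assms by (simp_all add: m_assoc[symmetric])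

lemma nat_prime_power_if:
  fixes n p :: nat
  assumes "n > 0" and only: "\<And>q. Factorial_Ring.prime q \<Longrightarrow> q dvd n \<Longrightarrow> q = p"
  shows "\<exists>i. n = p ^ i"
proof (cases "n = 1")
  case True
  then show ?thesis by (intro exI[of _ 0]) simp
next
  case False
  then obtain q k m where q: "Factorial_Ring.prime q" "q dvd n" "\<not> q dvd m" "n = q ^ k * m"
    using divide_out_primepow[of n] assms(1) by (metis nat_dvd_1_iff_1 not_gr_zero)
  have "m = 1"
  proof (rule ccontr)
    assume "m \<noteq> 1"
    then obtain r where r: "Factorial_Ring.prime r" "r dvd m" using prime_factor_nat by blast
    then have "r = p" using only[of r] q(4) by simp
    then show False using r only[OF q(1,2)] q(3) by simp
  qed
  then show ?thesis using q(4) only[OF q(1,2)] by auto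
qed

lemma (in group) finite_minimal_normal:
  assumes "finite (carrier G)"
  shows "finite {N. minimal_normal G N}"
proof (rule finite_subset)
  show "{N. minimal_normal G N} \<subseteq> Pow (carrier G)"
    by (auto simp: minimal_normal_def dest: normal_imp_subgroup subgroup.mem_carrier)
qed (use assms in simp)

text \<open>Every element of \<open>generate G {z}\<close> is central, so the subgroup is normal,
  and by Lagrange a group of prime order has only the two trivial subgroups.\<close>

lemma (in group) prime_order_central_minimal_normal:
  assumes fin: "finite (carrier G)" and z: "z \<in> carrier G" "z \<noteq> \<one>"
    and p: "Factorial_Ring.prime (p::nat)" "z [^] p = \<one>"
    and central: "\<And>g. g \<in> carrier G \<Longrightarrow> z \<otimes> g = g \<otimes> z"
  shows "minimal_normal G (generate G {z})" "card (generate G {z}) = p"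
proof -
  let ?P = "generate G {z}"
  have "ord z dvd p" using p(2) z(1) pow_eq_id by blast
  moreover have "ord z \<noteq> 1" using z ord_eq_1 by blast
  ultimately have "ord z = p" using p(1) by (auto simp: prime_nat_iff)
  then show card: "card ?P = p" using generate_pow_card z(1) by simp
  have sub: "subgroup ?P G" using generate_is_subgroup z(1) by simp
  have comm: "x \<otimes> g = g \<otimes> x" if "x \<in> ?P" "g \<in> carrier G" for x g
    using that(1)
  proof (induction rule: generate.induct)
    case (inv h)
    then have "h = z" by simp
    have "inv z \<otimes> g = inv z \<otimes> (g \<otimes> z) \<otimes> inv z" using z(1) that(2) by (simp add: m_assoc)
    also have "\<dots> = inv z \<otimes> (z \<otimes> g) \<otimes> inv z" using central that(2) by simp
    also have "\<dots> = g \<otimes> inv z" using z(1) that(2) by (simp add: m_assoc[symmetric])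
    finally show ?case using \<open>h = z\<close> by simp
  next
    case (eng h1 h2)
    then have "h1 \<in> carrier G" "h2 \<in> carrier G"
      using subgroup.mem_carrier[OF sub] by simp_all
    with that(2) eng.IH show ?case using m_assoc[of h1 h2 g] m_assoc[of h1 g h2] m_assoc[of g h1 h2] by simp
  qed (use that z central in auto)
  have "g \<otimes> x \<otimes> inv g \<in> ?P" if "x \<in> ?P" "g \<in> carrier G" for x g
    using that comm[OF that] subgroup.mem_carrier[OF sub that(1)] by (metis m_assoc r_inv r_one inv_closed)
  then have "?P \<lhd> G" using sub by (intro normal_invI) auto
  moreover have "?P \<noteq> {\<one>}" using generate.incl[of z "{z}" G] z(2) by auto
  moreover have "L = {\<one>} \<or> L = ?P" if L: "L \<lhd> G" "L \<subseteq> ?P" for L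
  proof -
    have Lsub: "subgroup L G" using L(1) normal_imp_subgroup by blast
    interpret P: group "G\<lparr>carrier := ?P\<rparr>" by (rule subgroup_imp_group[OF sub])
    have "subgroup L (G\<lparr>carrier := ?P\<rparr>)"
      by (rule subgroup_incl[OF Lsub sub L(2)])
    from P.lagrange[OF this] have "card (rcosets\<^bsub>G\<lparr>carrier := ?P\<rparr>\<^esub> L) * card L = p"
      using card by (simp add: Coset.order_def)
    then have "card L dvd p" by (metis dvd_triv_right)
    then have "card L = 1 \<or> card L = p" using p(1) by (auto simp: prime_nat_iff)
    moreover have "finite ?P" using finite_subset[OF subgroup.subset[OF sub] fin] .
    moreover have "\<one> \<in> L" using subgroup.one_closed[OF Lsub] .
    moreover have "L = {\<one>}" if "card L = 1" using card_1_singletonE[OF that] \<open>\<one> \<in> L\<close> by blast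
    ultimately show ?thesis using L(2) card card_subset_eq[of ?P L] by metis
  qed
  ultimately show "minimal_normal G ?P" unfolding minimal_normal_def by blast
qed

section \<open>Central solutions of \<open>z ^ m = 1\<close> and their number\<close>

definition central_torsion :: "('a, 'b) monoid_scheme \<Rightarrow> nat \<Rightarrow> 'a set" where
  "central_torsion G m =
     {z \<in> carrier G. (\<forall>g\<in>carrier G. z \<otimes>\<^bsub>G\<^esub> g = g \<otimes>\<^bsub>G\<^esub> z) \<and> z [^]\<^bsub>G\<^esub> m = \<one>\<^bsub>G\<^esub>}"

lemma (in group) central_torsionD:
  assumes "z \<in> central_torsion G m"
  shows "z \<in> carrier G" "g \<in> carrier G \<Longrightarrow> z \<otimes> g = g \<otimes> z" "z [^] m = \<one>"
  using assms by (auto simp: central_torsion_def)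

lemma (in group) central_torsion_mult:
  assumes "x \<in> central_torsion G m" "y \<in> central_torsion G m"
  shows "x \<otimes> y \<in> central_torsion G m"
proof -
  note X = central_torsionD[OF assms(1)] and Y = central_torsionD[OF assms(2)]
  have "(x \<otimes> y) [^] m = \<one>" using pow_mult_distrib[OF X(2)[OF Y(1)] X(1) Y(1)] X(3) Y(3) by simp
  moreover have "x \<otimes> y \<otimes> g = g \<otimes> (x \<otimes> y)" if "g \<in> carrier G" for g
    using X(1) Y(1) X(2)[OF that] Y(2)[OF that] that m_assoc[of x y g] m_assoc[of x g y] m_assoc[of g x y] by simp
  ultimately show ?thesis using X(1) Y(1) by (auto simp: central_torsion_def)
qed

lemma (in group) central_torsion_inv:
  assumes "x \<in> central_torsion G m"
  shows "inv x \<in> central_torsion G m"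
proof -
  note X = central_torsionD[OF assms(1)]
  have "(inv x) [^] m = \<one>" using nat_pow_inv X(1,3) by simp
  moreover have "inv x \<otimes> g = g \<otimes> inv x" if "g \<in> carrier G" for g
  proof -
    have "inv x \<otimes> g = inv x \<otimes> (g \<otimes> x) \<otimes> inv x" using X(1) that by (simp add: m_assoc)
    also have "\<dots> = inv x \<otimes> (x \<otimes> g) \<otimes> inv x" using X(2)[OF that] by simp
    also have "\<dots> = g \<otimes> inv x" using X(1) that by (simp add: m_assoc[symmetric])
    finally show ?thesis .
  qed
  ultimately show ?thesis using X(1) by (auto simp: central_torsion_def)
qed

text \<open>Two independent central elements of order \<open>p\<close> would generate three minimal normal subgroups,
  \<open>\<langle>n\<rangle>\<close>, \<open>\<langle>c\<rangle>\<close> and \<open>\<langle>c n\<rangle>\<close>.\<close>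

lemma (in group) card_central_torsion_prime:
  assumes fin: "finite (carrier G)" and p: "Factorial_Ring.prime (p::nat)"
    and two: "card {N. minimal_normal G N} \<le> 2"
  shows "card (central_torsion G p) \<le> p"
proof (cases "central_torsion G p \<subseteq> {\<one>}")
  case True
  then have "card (central_torsion G p) \<le> card {\<one>}" by (intro card_mono) auto
  then show ?thesis using prime_ge_1_nat[OF p] by simp
next
  case False
  then obtain n where n: "n \<in> central_torsion G p" "n \<noteq> \<one>" by blast
  let ?g = "\<lambda>x. generate G {x}"
  have mn: "minimal_normal G (?g z)" "card (?g z) = p"
    if "z \<in> central_torsion G p" "z \<noteq> \<one>" for z
    using prime_order_central_minimal_normal[OF fin _ that(2) p] central_torsionD[OF that(1)] by auto
  have sub: "subgroup (?g z) G" if "z \<in> central_torsion G p" for z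
    using generate_is_subgroup central_torsionD(1)[OF that] by simp
  have self: "z \<in> ?g z" for z using generate.incl by fast
  have finite: "finite (?g z)" if "z \<in> central_torsion G p" for z
    using finite_subset[OF subgroup.subset[OF sub[OF that]] fin] .
  have "c \<in> ?g n" if c: "c \<in> central_torsion G p" for c
  proof (rule ccontr)
    assume nin: "c \<notin> ?g n"
    have "\<one> \<in> ?g n" by (rule generate.one)
    then have c1: "c \<noteq> \<one>" using nin by auto
    have cn: "c \<otimes> n \<in> central_torsion G p" using c n central_torsion_mult by blast
    note C = central_torsionD[OF c] and N = central_torsionD[OF n(1)]
    have "c = inv n" if "c \<otimes> n = \<one>" using inv_equality[OF that N(1) C(1)] by simp
    then have cn1: "c \<otimes> n \<noteq> \<one>"
      using nin self sub[OF n(1)] subgroup.m_inv_closed by metis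
    have ne1: "?g c \<noteq> ?g n" using nin self by metis
    have ne2: "?g (c \<otimes> n) \<noteq> ?g n"
    proof
      assume "?g (c \<otimes> n) = ?g n"
      then have "c \<otimes> n \<in> ?g n" using self by metis
      then have "c \<otimes> n \<otimes> inv n \<in> ?g n"
        using self sub[OF n(1)] subgroup.m_inv_closed subgroup.m_closed by metis
      then show False using nin C(1) N(1) by (simp add: m_assoc)
    qed
    have ne3: "?g (c \<otimes> n) \<noteq> ?g c"
    proof
      assume "?g (c \<otimes> n) = ?g c"
      then have "c \<otimes> n \<in> ?g c" using self by metis
      then have "inv c \<otimes> (c \<otimes> n) \<in> ?g c"
        using self sub[OF c] subgroup.m_inv_closed subgroup.m_closed by metis
      then have "n \<in> ?g c" using C(1) N(1) by (simp add: m_assoc[symmetric])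
      \<comment> \<open>Both subgroups have order \<open>p\<close>, so this inclusion is an
        equality.\<close>
      then have "?g n \<subseteq> ?g c"
        using generate_subgroup_incl sub[OF c] by blast
      then have "?g n = ?g c"
        using card_subset_eq finite[OF c] mn(2)[OF c c1] mn(2)[OF n] by metis
      then show False using ne1 by simp
    qed
    have "card {?g n, ?g c, ?g (c \<otimes> n)} = 3" using ne1 ne2 ne3 by auto
    moreover have "card {?g n, ?g c, ?g (c \<otimes> n)} \<le> card {N. minimal_normal G N}"
      using mn(1) n c c1 cn cn1 finite_minimal_normal[OF fin] by (intro card_mono) auto
    ultimately show False using two by linarith
  qed
  then have "card (central_torsion G p) \<le> card (?g n)"
    using finite[OF n(1)] by (intro card_mono) auto
  then show ?thesis using mn(2)[OF n] by simp
qed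

lemma (in group) finite_central_torsion:
  "finite (carrier G) \<Longrightarrow> finite (central_torsion G m)"
  unfolding central_torsion_def by simp

text \<open>Induction by the map \<open>z\<close> to \<open>z ^ p\<close>, which sends central
  solutions for \<open>p ^ Suc k\<close> to central solutions for \<open>p ^ k\<close>. Two elements
  of one fibre differ by a central solution of \<open>x ^ p = 1\<close>, so each fibre has at most
  \<open>p\<close> elements.\<close>

lemma (in group) card_central_torsion_prime_power:
  assumes fin: "finite (carrier G)" and p: "Factorial_Ring.prime (p::nat)"
    and two: "card {N. minimal_normal G N} \<le> 2"
  shows "card (central_torsion G (p ^ k)) \<le> p ^ k"
proof (induction k)
  case 0
  have "central_torsion G (p ^ 0) \<subseteq> {\<one>}" by (auto simp: central_torsion_def)
  then have "card (central_torsion G (p ^ 0)) \<le> card {\<one>}" by (intro card_mono) auto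
  then show ?case by simp
next
  case (Suc k)
  let ?U = "central_torsion G (p ^ Suc k)"
  let ?F = "\<lambda>y. {z \<in> ?U. z [^] p = y}"
  have Ufin: "finite ?U" using finite_central_torsion fin .
  have img: "(\<lambda>z. z [^] p) ` ?U \<subseteq> central_torsion G (p ^ k)"
  proof clarify
    fix z assume "z \<in> ?U"
    note Z = central_torsionD[OF this]
    have "z [^] p \<otimes> g = g \<otimes> z [^] p" if "g \<in> carrier G" for g
      using group_commutes_pow[OF Z(2)[OF that] Z(1) that] .
    moreover have "(z [^] p) [^] (p ^ k) = \<one>" using Z(1,3) by (simp add: nat_pow_pow)
    ultimately show "z [^] p \<in> central_torsion G (p ^ k)" using Z(1) by (auto simp: central_torsion_def)
  qed
  have fib: "card (?F y) \<le> p" if "y \<in> (\<lambda>z. z [^] p) ` ?U" for y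
  proof -
    from that obtain w where w: "w \<in> ?U" "w [^] p = y" by auto
    note W = central_torsionD[OF w(1)]
    \<comment> \<open>Dividing by one chosen element \<open>w\<close> of the fibre embeds the fibre
      into the central solutions of \<open>x ^ p = 1\<close>.\<close>
    have "(\<lambda>z. z \<otimes> inv w) ` ?F y \<subseteq> central_torsion G p"
    proof clarify
      fix z assume z: "z \<in> ?U" "y = z [^] p"
      note Z = central_torsionD[OF z(1)]
      have mem: "z \<otimes> inv w \<in> ?U" using central_torsion_mult central_torsion_inv z w by blast
      have "(z \<otimes> inv w) [^] p = z [^] p \<otimes> inv w [^] p"
        using pow_mult_distrib[OF Z(2)] Z(1) W(1) by auto
      also have "inv w [^] p = inv (z [^] p)" using w(2) z(2) W(1) nat_pow_inv by simp
      finally have "(z \<otimes> inv w) [^] p = \<one>" using Z(1) by simp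
      then show "z \<otimes> inv w \<in> central_torsion G p" using mem by (auto simp: central_torsion_def)
    qed
    moreover have "inj_on (\<lambda>z. z \<otimes> inv w) (?F y)"
      using W(1) central_torsionD(1) by (intro inj_onI) (metis (no_types, lifting) CollectD inv_closed r_cancel)
    ultimately have "card (?F y) \<le> card (central_torsion G p)"
      using card_inj_on_le finite_central_torsion fin by metis
    then show ?thesis using card_central_torsion_prime[OF fin p two] by linarith
  qed
  have "?U = (\<Union>y\<in>(\<lambda>z. z [^] p) ` ?U. ?F y)" by auto
  then have "card ?U \<le> (\<Sum>y\<in>(\<lambda>z. z [^] p) ` ?U. card (?F y))"
    using card_UN_le[of "(\<lambda>z. z [^] p) ` ?U" ?F] Ufin by simp
  also have "\<dots> \<le> (\<Sum>y\<in>(\<lambda>z. z [^] p) ` ?U. p)" using fib by (rule sum_mono)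
  also have "\<dots> \<le> card (central_torsion G (p ^ k)) * p"
    using card_mono[OF finite_central_torsion[OF fin] img] by simp
  also have "\<dots> \<le> p ^ Suc k" using Suc by simp
  finally show ?case .
qed

text \<open>Let \<open>p ^ i\<close> be the largest order of an element of \<open>K\<close>. The
  cyclic subgroup it generates gives \<open>K\<close> at least \<open>p ^ i\<close> elements, while
  all other orders divide \<open>p ^ i\<close>, so \<open>K\<close> lies in a set of at most
  \<open>p ^ i\<close> elements.\<close>

lemma (in group) central_p_subgroup_eq_torsion:
  assumes fin: "finite (carrier G)" and p: "Factorial_Ring.prime (p::nat)"
    and two: "card {N. minimal_normal G N} \<le> 2"
    and K: "subgroup K G" and central: "\<And>k g. k \<in> K \<Longrightarrow> g \<in> carrier G \<Longrightarrow> k \<otimes> g = g \<otimes> k"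
    and ord: "\<And>k. k \<in> K \<Longrightarrow> \<exists>i. ord k = p ^ i"
  shows "\<exists>i. K = central_torsion G (p ^ i)"
proof -
  have Kfin: "finite K" using finite_subset[OF subgroup.subset[OF K] fin] .
  have Kne: "K \<noteq> {}" using subgroup.one_closed[OF K] by blast
  obtain a where a: "a \<in> K" "ord a = Max (ord ` K)"
    using Max_in[of "ord ` K"] Kfin Kne by (metis finite_imageI image_iff image_is_empty)
  from ord[OF a(1)] obtain i where i: "ord a = p ^ i" by blast
  have Kcar: "k \<in> carrier G" if "k \<in> K" for k using subgroup.mem_carrier[OF K that] .
  have sub: "K \<subseteq> central_torsion G (p ^ i)"
  proof
    fix k assume k: "k \<in> K"
    then obtain j where j: "ord k = p ^ j" using ord by blast
    have "p ^ j \<le> p ^ i" using a Kfin k i j by (metis Max_ge finite_imageI imageI)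
    then have "j \<le> i" using prime_gt_1_nat[OF p] power_le_imp_le_exp by blast
    then have "ord k dvd p ^ i" using j le_imp_power_dvd by simp
    then have "k [^] (p ^ i) = \<one>" using pow_eq_id[OF Kcar[OF k]] by simp
    then show "k \<in> central_torsion G (p ^ i)" using k central Kcar by (auto simp: central_torsion_def)
  qed
  have "generate G {a} \<subseteq> K" using generate_subgroup_incl K a by blast
  then have "p ^ i \<le> card K"
    using generate_pow_card[OF Kcar[OF a(1)]] i card_mono[OF Kfin] by metis
  then have "card K = card (central_torsion G (p ^ i))"
    using card_central_torsion_prime_power[OF fin p two, of i] card_mono[OF finite_central_torsion[OF fin] sub] by linarith
  then show ?thesis using card_subset_eq[OF finite_central_torsion[OF fin] sub] by blast
qed

lemma (in group) central_torsion_mono: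
  assumes "m dvd n"
  shows "central_torsion G m \<subseteq> central_torsion G n"
proof -
  obtain k where n: "n = m * k" using assms by blast
  have "z [^] n = \<one>" if "z \<in> carrier G" "z [^] m = \<one>" for z
    using that n nat_pow_pow[of z m k] by simp
  then show ?thesis by (auto simp: central_torsion_def)
qed

text \<open>Each element of prime order in \<open>K1\<close> or \<open>K2\<close> generates a
  minimal normal subgroup other than \<open>D\<close>, and there is room for only one such. Hence a
  single prime \<open>p\<close> occurs, both subgroups are torsion sets for powers of
  \<open>p\<close>, and those are nested by exponent.\<close>

lemma (in group) central_subgroups_comparable:
  assumes fin: "finite (carrier G)" and two: "card {N. minimal_normal G N} \<le> 2"
    and D: "minimal_normal G D"
    and K: "subgroup K1 G" "subgroup K2 G"
    and central: "\<And>k g. k \<in> K1 \<union> K2 \<Longrightarrow> g \<in> carrier G \<Longrightarrow> k \<otimes> g = g \<otimes> k"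
    and nD: "\<not> D \<subseteq> K1" "\<not> D \<subseteq> K2"
  shows "K1 \<subseteq> K2 \<or> K2 \<subseteq> K1"
proof -
  let ?g = "\<lambda>x. generate G {x}"
  have Kcar: "k \<in> carrier G" if "k \<in> K1 \<union> K2" for k
    using that subgroup.mem_carrier[OF K(1)] subgroup.mem_carrier[OF K(2)] by blast
  \<comment> \<open>The subgroup generated by \<open>k\<close> lies in \<open>K1\<close> or in
    \<open>K2\<close>, whereas \<open>D\<close> lies in neither.\<close>
  have gD: "?g k \<noteq> D" if "k \<in> K1 \<union> K2" for k
    using that nD generate_subgroup_incl[OF _ K(1), of "{k}"] generate_subgroup_incl[OF _ K(2), of "{k}"] by auto
  have powK: "k [^] m \<in> K1 \<union> K2" if "k \<in> K1 \<union> K2" for k and m :: nat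
    using that subgroup_int_pow_closed[OF K(1), of k "int m"] subgroup_int_pow_closed[OF K(2), of k "int m"]
    by (auto simp: int_pow_int)
  have prime_elt: "\<exists>x\<in>K1 \<union> K2. x \<noteq> \<one> \<and> x [^] q = \<one>"
    if "k \<in> K1 \<union> K2" "Factorial_Ring.prime (q::nat)" "q dvd ord k" for k q
  proof -
    \<comment> \<open>The witness is \<open>k ^ m\<close> with \<open>m = ord k / q\<close>, an
      element of order \<open>q\<close>.\<close>
    from that(3) obtain m where m: "ord k = q * m" by blast
    have "ord k > 0" using ord_ge_1[OF fin Kcar[OF that(1)]] by simp
    then have "m > 0" using m by simp
    have "k [^] m \<noteq> \<one>"
    proof
      assume "k [^] m = \<one>"
      then have "q * m dvd m" using pow_eq_id[OF Kcar[OF that(1)]] m by simp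
      then show False using \<open>m > 0\<close> prime_gt_1_nat[OF that(2)] by (simp add: nat_dvd_not_less)
    qed
    moreover have "(k [^] m) [^] q = \<one>"
      using nat_pow_pow Kcar that(1) m pow_ord_eq_1 by (metis mult.commute)
    ultimately show ?thesis using powK[OF that(1)] by blast
  qed
  have same_prime: "q = r"
    if q: "x \<in> K1 \<union> K2" "x \<noteq> \<one>" "x [^] q = \<one>" "Factorial_Ring.prime (q::nat)"
      and r: "y \<in> K1 \<union> K2" "y \<noteq> \<one>" "y [^] r = \<one>" "Factorial_Ring.prime (r::nat)" for x y q r
  proof -
    have X: "minimal_normal G (?g x)" "card (?g x) = q"
      using prime_order_central_minimal_normal[OF fin Kcar[OF q(1)] q(2) q(4,3)] central q(1) by blast+
    have Y: "minimal_normal G (?g y)" "card (?g y) = r"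
      using prime_order_central_minimal_normal[OF fin Kcar[OF r(1)] r(2) r(4,3)] central r(1) by blast+
    \<comment> \<open>Otherwise these two and \<open>D\<close> are three distinct minimal normal
      subgroups. The orders of the two are \<open>q\<close> and \<open>r\<close>, so equality
      identifies the primes.\<close>
    have "?g x = ?g y"
    proof (rule ccontr)
      assume "?g x \<noteq> ?g y"
      then have "card {D, ?g x, ?g y} = 3" using gD q r by (metis card_3_iff)
      moreover have "card {D, ?g x, ?g y} \<le> card {N. minimal_normal G N}"
        using X Y D finite_minimal_normal[OF fin] by (intro card_mono) auto
      ultimately show False using two by linarith
    qed
    then show ?thesis using X Y by simp
  qed
  show ?thesis
  proof (cases "K1 \<union> K2 \<subseteq> {\<one>}")
    case True
    then show ?thesis using subgroup.one_closed[OF K(1)] subgroup.one_closed[OF K(2)] by blast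
  next
    case False
    then obtain k where k: "k \<in> K1 \<union> K2" "k \<noteq> \<one>" by blast
    then have "ord k \<noteq> 1" using ord_eq_1 Kcar by blast
    then obtain p where p: "Factorial_Ring.prime (p::nat)" "p dvd ord k" using prime_factor_nat by blast
    obtain x where x: "x \<in> K1 \<union> K2" "x \<noteq> \<one>" "x [^] p = \<one>" using prime_elt[OF k(1) p] by blast
    have ord: "\<exists>i. ord y = p ^ i" if y: "y \<in> K1 \<union> K2" for y
    proof -
      have "ord y > 0" using ord_ge_1[OF fin Kcar[OF y]] by simp
      moreover have "q = p" if "Factorial_Ring.prime q" "q dvd ord y" for q
        using prime_elt[OF y that] same_prime[OF _ _ _ _ x p(1)] that by blast
      ultimately show ?thesis by (rule nat_prime_power_if)
    qed
    obtain i j where "K1 = central_torsion G (p ^ i)" "K2 = central_torsion G (p ^ j)"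
      using central_p_subgroup_eq_torsion[OF fin p(1) two K(1)]
        central_p_subgroup_eq_torsion[OF fin p(1) two K(2)] central ord by blast
    then show ?thesis
      using central_torsion_mono[OF le_imp_power_dvd, of i j p] central_torsion_mono[OF le_imp_power_dvd, of j i p]
      by (metis nat_le_linear)
  qed
qed

section \<open>Chief factors and minimal normal subgroups of quotients\<close>

lemma (in normal) image_quotient_normal:
  assumes "N \<lhd> G"
  shows "(\<lambda>x. H #> x) ` N \<lhd> G Mod H"
proof (rule normal.surj_hom_normal_subgroup[OF assms])
  show "group_hom G (G Mod H) (\<lambda>x. H #> x)"
    using r_coset_hom_Mod factorgroup_is_group by (simp add: group_hom_def group_hom_axioms_def is_group)
  show "(\<lambda>x. H #> x) ` carrier G = carrier (G Mod H)" by (simp add: carrier_FactGroup)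
qed

text \<open>Elements of \<open>G Mod H\<close> are cosets, hence sets, so \<open>Union\<close> is
  the preimage under the projection. Together with \<open>image_quotient_Union\<close> this gives
  the correspondence theorem, with image and \<open>Union\<close> as inverse maps.\<close>

lemma (in normal) Union_image_quotient:
  assumes N: "N \<lhd> G" "H \<subseteq> N"
  shows "\<Union> ((\<lambda>x. H #> x) ` N) = N"
proof
  have sub: "subgroup N G" using N(1) normal_imp_subgroup by blast
  show "\<Union> ((\<lambda>x. H #> x) ` N) \<subseteq> N"
    using N(2) subgroup.m_closed[OF sub] by (auto simp: r_coset_def)
  show "N \<subseteq> \<Union> ((\<lambda>x. H #> x) ` N)"
    using rcos_self[OF subgroup.mem_carrier[OF sub]] subgroup_axioms by blast
qed

lemma (in normal) image_quotient_Union: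
  assumes L: "L \<lhd> G Mod H"
  shows "(\<lambda>x. H #> x) ` \<Union>L = L"
proof -
  have sub: "subgroup L (G Mod H)" using L normal_imp_subgroup by blast
  have U: "\<Union>L = {x \<in> carrier G. H #> x \<in> L}" by (rule factgroup_subgroup_union_char[OF sub])
  have "L \<subseteq> (\<lambda>x. H #> x) ` carrier G"
    using subgroup.subset[OF sub] by (simp add: carrier_FactGroup)
  then show ?thesis unfolding U by auto
qed

lemma (in normal) subset_Union_quotient:
  assumes L: "L \<lhd> G Mod H"
  shows "H \<subseteq> \<Union>L"
  using subgroup.one_closed[OF normal_imp_subgroup[OF L]] by auto

text \<open>The correspondence preserves inclusions and matches the trivial subgroup of
  \<open>G Mod H\<close> with \<open>H\<close>. This moves condition (2) from the quotients into
  \<open>G\<close> itself.\<close>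

lemma (in normal) minimal_normal_quotient_iff:
  assumes L: "L \<lhd> G Mod H"
  shows "minimal_normal (G Mod H) L \<longleftrightarrow> chief_factor G (\<Union>L) H"
proof -
  let ?q = "\<lambda>N. (\<lambda>x. H #> x) ` N"
  have HG: "H \<lhd> G" by (rule normal_axioms)
  have "?q H = (\<lambda>x. H) ` H" using rcos_const[OF is_group] by (intro image_cong) auto
  then have qH: "?q H = {\<one>\<^bsub>G Mod H\<^esub>}"
    using image_constant[OF subgroup.one_closed[OF subgroup_axioms], of H] by simp
  have U: "\<Union>L \<lhd> G" using L by (rule factgroup_subgroup_union_normal)
  have qU: "?q (\<Union>L) = L" by (rule image_quotient_Union[OF L])
  show ?thesis
  proof
    assume min: "minimal_normal (G Mod H) L"
    have "\<Union>L \<noteq> H" using min qH qU by (metis minimal_normal_def)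
    moreover have False if N: "N \<lhd> G" "H \<subset> N" "N \<subset> \<Union>L" for N
    proof -
      have "?q N \<subseteq> L" using N(3) qU by blast
      then have "?q N = {\<one>\<^bsub>G Mod H\<^esub>} \<or> ?q N = L"
        using min image_quotient_normal[OF N(1)] by (auto simp: minimal_normal_def)
      moreover have "\<Union> (?q N) = N" using Union_image_quotient[OF N(1)] N(2) by blast
      ultimately show False using N by auto
    qed
    ultimately show "chief_factor G (\<Union>L) H"
      unfolding chief_factor_def using HG U subset_Union_quotient[OF L] by blast
  next
    assume chief: "chief_factor G (\<Union>L) H"
    have "L \<noteq> {\<one>\<^bsub>G Mod H\<^esub>}" using chief by (auto simp: chief_factor_def)
    moreover have "L' = {\<one>\<^bsub>G Mod H\<^esub>} \<or> L' = L" if L': "L' \<lhd> G Mod H" "L' \<subseteq> L" for L'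
    proof -
      have "\<Union>L' \<lhd> G" using L'(1) by (rule factgroup_subgroup_union_normal)
      moreover have "\<Union>L' \<subseteq> \<Union>L" using L'(2) by blast
      ultimately have "\<Union>L' = H \<or> \<Union>L' = \<Union>L"
        using chief subset_Union_quotient[OF L'(1)] unfolding chief_factor_def by blast
      then show ?thesis using qH qU image_quotient_Union[OF L'(1)] by metis
    qed
    ultimately show "minimal_normal (G Mod H) L" using L by (auto simp: minimal_normal_def)
  qed
qed

lemma (in normal) card_minimal_normal_quotient:
  "card {L. minimal_normal (G Mod H) L} = card {N. chief_factor G N H}"
proof (rule bij_betw_same_card[of Union])
  show "bij_betw Union {L. minimal_normal (G Mod H) L} {N. chief_factor G N H}"
  proof (rule bij_betw_byWitness[where f' = "\<lambda>N. (\<lambda>x. H #> x) ` N"])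
    show "\<forall>L\<in>{L. minimal_normal (G Mod H) L}. (\<lambda>x. H #> x) ` \<Union>L = L"
      using image_quotient_Union by (auto simp: minimal_normal_def)
    show "\<forall>N\<in>{N. chief_factor G N H}. \<Union> ((\<lambda>x. H #> x) ` N) = N"
      using Union_image_quotient by (auto simp: chief_factor_def)
    show "Union ` {L. minimal_normal (G Mod H) L} \<subseteq> {N. chief_factor G N H}"
      using minimal_normal_quotient_iff by (auto simp: minimal_normal_def)
    show "(\<lambda>N. (\<lambda>x. H #> x) ` N) ` {N. chief_factor G N H} \<subseteq> {L. minimal_normal (G Mod H) L}"
    proof clarify
      fix N assume N: "chief_factor G N H"
      then have "N \<lhd> G" "H \<subseteq> N" by (auto simp: chief_factor_def)
      then show "minimal_normal (G Mod H) ((\<lambda>x. H #> x) ` N)"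
        using minimal_normal_quotient_iff[OF image_quotient_normal] Union_image_quotient N by simp
    qed
  qed
qed

text \<open>Take a minimal element among the finitely many normal subgroups strictly above
  \<open>M\<close> and inside \<open>K\<close>.\<close>

lemma (in group) exists_chief_factor_above:
  assumes fin: "finite (carrier G)" and "M \<lhd> G" "K \<lhd> G" "M \<subset> K"
  shows "\<exists>N. chief_factor G N M \<and> N \<subseteq> K"
proof -
  let ?S = "{N. N \<lhd> G \<and> M \<subset> N \<and> N \<subseteq> K}"
  have "?S \<noteq> {}" using assms by blast
  have "?S \<subseteq> Pow (carrier G)"
    by (auto dest: normal_imp_subgroup subgroup.mem_carrier)
  then have "finite ?S" using fin finite_subset by blast
  from finite_has_minimal[OF this \<open>?S \<noteq> {}\<close>] obtain N where N: "N \<in> ?S" "\<forall>L\<in>?S. L \<subseteq> N \<longrightarrow> N = L"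
    by (elim bexE)
  then have "chief_factor G N M" unfolding chief_factor_def using assms(2) by blast
  then show ?thesis using N(1) by blast
qed

section \<open>Commutators and commuting cosets\<close>

lemma (in group) commutator_in_derived:
  "x \<in> carrier G \<Longrightarrow> y \<in> carrier G \<Longrightarrow> x \<otimes> y \<otimes> inv x \<otimes> inv y \<in> derived G (carrier G)"
  unfolding derived_def by (intro generate.incl) auto

lemma (in group) mult_eq_commutator_mult:
  assumes "x \<in> carrier G" "y \<in> carrier G"
  shows "x \<otimes> y = (x \<otimes> y \<otimes> inv x \<otimes> inv y) \<otimes> (y \<otimes> x)"
  using assms by (simp add: m_assoc mult_inv_cancel)

text \<open>From \<open>x y = [x, y] y x\<close>, the cosets of \<open>x y\<close> and
  \<open>y x\<close> agree. This later makes subgroups of \<open>G/M\<close> central once their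
  commutators with \<open>G\<close> fall into \<open>M\<close>.\<close>

lemma (in group) commutator_coset_eq:
  assumes M: "M \<lhd> G" and xy: "x \<in> carrier G" "y \<in> carrier G"
    and comm: "x \<otimes> y \<otimes> inv x \<otimes> inv y \<in> M"
  shows "(M #> x) <#> (M #> y) = (M #> y) <#> (M #> x)"
proof -
  interpret M: normal M G by (rule M)
  have "x \<otimes> y = (x \<otimes> y \<otimes> inv x \<otimes> inv y) \<otimes> (y \<otimes> x)"
    using xy by (rule mult_eq_commutator_mult)
  then have "x \<otimes> y \<in> M #> (y \<otimes> x)" using comm by (auto simp: r_coset_def)
  then have "M #> (x \<otimes> y) = M #> (y \<otimes> x)"
    using repr_independence[of "x \<otimes> y" M "y \<otimes> x"] xy M.subgroup_axioms by simp
  then show ?thesis using xy by (simp add: M.rcos_sum)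
qed

text \<open>The commutator is \<open>x\<close> times a conjugate of \<open>inv x\<close>.\<close>

lemma (in group) commutator_in_normal:
  assumes K: "K \<lhd> G" and "x \<in> K" "y \<in> carrier G"
  shows "x \<otimes> y \<otimes> inv x \<otimes> inv y \<in> K"
proof -
  interpret K: normal K G by (rule K)
  have x: "x \<in> carrier G" using K.mem_carrier assms(2) .
  have "y \<otimes> inv x \<otimes> inv y \<in> K" using K.inv_op_closed2 assms(2,3) by simp
  then have "x \<otimes> (y \<otimes> inv x \<otimes> inv y) \<in> K" using K.m_closed assms(2) by blast
  then show ?thesis using x assms(3) by (simp add: m_assoc)
qed

section \<open>The chain condition in terms of chief factors\<close>

definition normals_avoiding_derived_chain :: "('a, 'b) monoid_scheme \<Rightarrow> bool" where
  "normals_avoiding_derived_chain G \<longleftrightarrow>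
     (\<forall>K1 K2. K1 \<lhd> G \<longrightarrow> K2 \<lhd> G \<longrightarrow> \<not> derived G (carrier G) \<subseteq> K1 \<longrightarrow> \<not> derived G (carrier G) \<subseteq> K2
        \<longrightarrow> K1 \<subseteq> K2 \<or> K2 \<subseteq> K1)"

text \<open>The subgroups \<open>N\<close> with \<open>N/M\<close> a chief factor form an antichain,
  so the chain condition leaves at most one that does not contain \<open>G'\<close>, and the only
  possible one containing \<open>G'\<close> is \<open>G'\<close> itself. For the converse, two given
  subgroups are compared modulo their common intersection with \<open>G'\<close>.\<close>

lemma (in group) normals_chain_iff_chief_factors:
  assumes fin: "finite (carrier G)"
  shows "normals_avoiding_derived_chain G \<longleftrightarrow>
    (\<forall>M. M \<lhd> G \<and> M \<subset> derived G (carrier G) \<longrightarrow>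
        (\<not> chief_factor G (derived G (carrier G)) M \<and> card {N. minimal_normal (G Mod M) N} = 1)
      \<or> (chief_factor G (derived G (carrier G)) M \<and> card {N. minimal_normal (G Mod M) N} \<le> 2))"
    (is "_ \<longleftrightarrow> (\<forall>M. M \<lhd> G \<and> M \<subset> ?D \<longrightarrow> ?P M)")
proof
  assume chain: "normals_avoiding_derived_chain G"
  show "\<forall>M. M \<lhd> G \<and> M \<subset> ?D \<longrightarrow> ?P M"
  proof (intro allI impI, elim conjE)
    fix M assume M: "M \<lhd> G" "M \<subset> ?D"
    let ?C = "{N. chief_factor G N M}"
    have card: "card {N. minimal_normal (G Mod M) N} = card ?C"
      by (rule normal.card_minimal_normal_quotient[OF M(1)])
    have uniq: "N = L" if "N \<in> ?C" "L \<in> ?C" "\<not> ?D \<subseteq> N" "\<not> ?D \<subseteq> L" for N L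
    proof -
      have "N \<subseteq> L \<or> L \<subseteq> N" using chain that by (auto simp: normals_avoiding_derived_chain_def chief_factor_def)
      then show ?thesis using that unfolding chief_factor_def by blast
    qed
    \<comment> \<open>Otherwise \<open>G'\<close> would lie strictly between \<open>M\<close> and
      \<open>N\<close>.\<close>
    have above: "N = ?D" if "N \<in> ?C" "?D \<subseteq> N" for N
      using that M(2) derived_self_is_normal unfolding chief_factor_def by blast
    show "?P M"
    proof (cases "chief_factor G ?D M")
      case True
      have "\<exists>N. ?C \<subseteq> {?D, N}"
      proof (cases "?C \<subseteq> {?D}")
        case False
        then obtain N where N: "N \<in> ?C" "N \<noteq> ?D" by blast
        have "L = N" if "L \<in> ?C" "L \<noteq> ?D" for L
          using uniq[OF that(1) N(1)] above[OF that(1)] above[OF N(1)] that N by metis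
        then show ?thesis by blast
      qed blast
      then obtain N where "?C \<subseteq> {?D, N}" by blast
      then have "card ?C \<le> card {?D, N}" by (intro card_mono) auto
      also have "\<dots> \<le> 2" by (simp add: card_insert_if)
      finally show ?thesis using True card by simp
    next
      case False
      obtain N where N: "N \<in> ?C" using exists_chief_factor_above[OF fin M(1) derived_self_is_normal M(2)] by blast
      have "\<not> ?D \<subseteq> L" if "L \<in> ?C" for L using above[OF that] False that by blast
      then have "?C = {N}" using uniq N by blast
      then show ?thesis using False card by simp
    qed
  qed
next
  assume two: "\<forall>M. M \<lhd> G \<and> M \<subset> ?D \<longrightarrow> ?P M"
  show "normals_avoiding_derived_chain G"
    unfolding normals_avoiding_derived_chain_def
  proof (intro allI impI)
    fix K1 K2 assume K: "K1 \<lhd> G" "K2 \<lhd> G" and nD: "\<not> ?D \<subseteq> K1" "\<not> ?D \<subseteq> K2"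
    define M where "M = K1 \<inter> K2 \<inter> ?D"
    have DG: "?D \<lhd> G" by (rule derived_self_is_normal)
    have M: "M \<lhd> G" "M \<subset> ?D"
      using normal_subgroup_intersect[OF normal_subgroup_intersect[OF K] DG] nD unfolding M_def by auto
    interpret M: normal M G by (rule M)
    let ?q = "\<lambda>x. M #> x"
    have card: "card {N. minimal_normal (G Mod M) N} = card {N. chief_factor G N M}"
      by (rule M.card_minimal_normal_quotient)
    from two M consider (a) "card {N. chief_factor G N M} = 1"
      | (b) "chief_factor G ?D M" "card {N. minimal_normal (G Mod M) N} \<le> 2"
      unfolding card[symmetric] by blast
    then show "K1 \<subseteq> K2 \<or> K2 \<subseteq> K1"
    proof cases
      case a
      then obtain N where N: "{N. chief_factor G N M} = {N}" using card_1_singletonE by blast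
      have "N \<subseteq> K" if "K \<lhd> G" "M \<subset> K" for K
        using exists_chief_factor_above[OF fin M(1) that] N by blast
      moreover have "chief_factor G N M" using N by blast
      then have "M \<subset> N" by (simp add: chief_factor_def)
      \<comment> \<open>If \<open>K1\<close>, \<open>K2\<close> and \<open>G'\<close> were all
        strictly above \<open>M\<close>, then \<open>N\<close> would lie in each of them, hence in
        \<open>M\<close>.\<close>
      ultimately have "M = K1 \<or> M = K2" using K DG M(2) unfolding M_def by blast
      then show ?thesis unfolding M_def by blast
    next
      case b
      \<comment> \<open>The intersection is normal, contains \<open>M\<close> and is properly
        contained in \<open>G'\<close>, and \<open>G'/M\<close> is a chief factor.\<close>
      have KM: "K \<inter> ?D = M" if "K = K1 \<or> K = K2" for K
      proof -
        have "K \<inter> ?D \<lhd> G" "M \<subseteq> K \<inter> ?D" "K \<inter> ?D \<subset> ?D"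
          using that nD normal_subgroup_intersect[OF K(1) DG] normal_subgroup_intersect[OF K(2) DG] unfolding M_def by auto
        then show ?thesis using b(1) unfolding chief_factor_def by blast
      qed
      have qD: "minimal_normal (G Mod M) (?q ` ?D)"
        using M.minimal_normal_quotient_iff[OF M.image_quotient_normal[OF DG]]
          M.Union_image_quotient[OF DG] M(2) b(1) by auto
      have U: "\<Union> (?q ` K) = K" if "K = K1 \<or> K = K2" for K
        using M.Union_image_quotient K that unfolding M_def by blast
      have UD: "\<Union> (?q ` ?D) = ?D" using M.Union_image_quotient[OF DG] M(2) by blast
      \<comment> \<open>A commutator of an element of \<open>K\<close> with any element lies in
        \<open>K \<inter> G' = M\<close>, so it vanishes in the quotient.\<close>
      have central: "k \<otimes>\<^bsub>G Mod M\<^esub> g = g \<otimes>\<^bsub>G Mod M\<^esub> k"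
        if k: "k \<in> ?q ` K1 \<union> ?q ` K2" and g: "g \<in> carrier (G Mod M)" for k g
      proof -
        from k obtain K x where x: "K = K1 \<or> K = K2" "x \<in> K" "k = ?q x" by blast
        from g obtain y where y: "y \<in> carrier G" "g = ?q y" by (auto simp: carrier_FactGroup)
        have KG: "K \<lhd> G" using x(1) K by blast
        have xG: "x \<in> carrier G" by (rule subgroup.mem_carrier[OF normal_imp_subgroup[OF KG] x(2)])
        have "x \<otimes> y \<otimes> inv x \<otimes> inv y \<in> K \<inter> ?D"
          using commutator_in_normal[OF KG x(2) y(1)] commutator_in_derived[OF xG y(1)] by blast
        then show ?thesis
          using commutator_coset_eq[OF M(1) xG y(1)] KM[OF x(1)] x(3) y(2) by simp
      qed
      have "\<not> ?q ` ?D \<subseteq> ?q ` K1" "\<not> ?q ` ?D \<subseteq> ?q ` K2"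
        using U UD nD Union_mono by metis+
      moreover have "finite (carrier (G Mod M))" using fin by (simp add: carrier_FactGroup)
      moreover have "subgroup (?q ` K1) (G Mod M)" "subgroup (?q ` K2) (G Mod M)"
        using M.image_quotient_normal[OF K(1)] M.image_quotient_normal[OF K(2)] by (simp_all add: normal_imp_subgroup)
      ultimately have "?q ` K1 \<subseteq> ?q ` K2 \<or> ?q ` K2 \<subseteq> ?q ` K1"
        using group.central_subgroups_comparable[OF M.factorgroup_is_group _ b(2) qD _ _ central] by blast
      then show ?thesis using U Union_mono by metis
    qed
  qed
qed

section \<open>Kernels of characters\<close>

lemma mat_mult_index_sum:
  assumes "A \<in> carrier_mat n n" "B \<in> carrier_mat n n" "i < n" "j < n"
  shows "(A * B) $$ (i, j) = (\<Sum>l<n. A $$ (i, l) * B $$ (l, j))"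
  using assms by (auto simp: scalar_prod_def lessThan_atLeast0 intro!: sum.cong)

lemma mat_trace_mult_commute:
  assumes "A \<in> carrier_mat n n" "B \<in> carrier_mat n n"
  shows "mat_trace (A * B) = mat_trace (B * A)"
proof -
  have "mat_trace (A * B) = (\<Sum>i<n. \<Sum>l<n. A $$ (i, l) * B $$ (l, i))"
    using assms by (simp add: mat_trace_def mat_mult_index_sum[OF assms] del: index_mult_mat(1))
  also have "\<dots> = (\<Sum>l<n. \<Sum>i<n. B $$ (l, i) * A $$ (i, l))"
    by (subst sum.swap) (simp add: mult.commute)
  also have "\<dots> = mat_trace (B * A)"
    using assms by (simp add: mat_trace_def mat_mult_index_sum[OF assms(2,1)] del: index_mult_mat(1))
  finally show ?thesis .
qed

lemma mat_trace_similar: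
  assumes "similar_mat_wit A B P Q"
  shows "mat_trace A = mat_trace B"
proof -
  define n where "n = dim_row A"
  have car: "A \<in> carrier_mat n n" "B \<in> carrier_mat n n" "P \<in> carrier_mat n n" "Q \<in> carrier_mat n n"
    and PQ: "Q * P = 1\<^sub>m n" "A = P * B * Q"
    using similar_mat_witD[OF n_def assms] by auto
  have "mat_trace A = mat_trace (P * (B * Q))" using PQ(2) car assoc_mult_mat[OF car(3,2,4)] by simp
  also have "\<dots> = mat_trace (B * Q * P)" using mat_trace_mult_commute[of P n "B * Q"] car by simp
  also have "\<dots> = mat_trace B" using assoc_mult_mat[OF car(2,4,3)] PQ(1) right_mult_one_mat[OF car(2)] by simp
  finally show ?thesis .
qed

text \<open>Outside \<open>i..j\<close> one of the two factors is below its diagonal. With this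
  range the sum is empty below the diagonal and has a single term on it.\<close>

lemma upper_triangular_mult_index:
  assumes A: "A \<in> carrier_mat n n" "upper_triangular A" and B: "B \<in> carrier_mat n n" "upper_triangular B"
    and ij: "i < n" "j < n"
  shows "(A * B) $$ (i, j) = (\<Sum>l = i..j. A $$ (i, l) * B $$ (l, j))"
proof -
  have "(A * B) $$ (i, j) = (\<Sum>l<n. A $$ (i, l) * B $$ (l, j))"
    using mat_mult_index_sum A B ij by blast
  also have "\<dots> = (\<Sum>l = i..j. A $$ (i, l) * B $$ (l, j))"
  proof (rule sum.mono_neutral_right)
    show "\<forall>l\<in>{..<n} - {i..j}. A $$ (i, l) * B $$ (l, j) = 0"
      using A B ij by (auto simp: upper_triangular_def not_le)
  qed (use ij in auto)
  finally show ?thesis .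
qed

lemma upper_triangular_pow:
  assumes B: "(B :: 'a :: comm_ring_1 mat) \<in> carrier_mat n n" "upper_triangular B"
  shows "upper_triangular (B ^\<^sub>m k)" "i < n \<Longrightarrow> (B ^\<^sub>m k) $$ (i, i) = (B $$ (i, i)) ^ k"
proof (induction k)
  case 0
  { case 1 then show ?case using B by (auto simp: upper_triangular_def) }
  { case 2 then show ?case using B by auto }
next
  case (Suc k)
  have car: "B ^\<^sub>m k \<in> carrier_mat n n" using B by simp
  { case 1
    show ?case unfolding upper_triangular_def
    proof (intro allI impI)
      fix i j assume "i < dim_row (B ^\<^sub>m Suc k)" "j < i"
      then have "i < n" "j < n" "{i..j} = {}" using B by auto
      then show "(B ^\<^sub>m Suc k) $$ (i, j) = 0"
        using upper_triangular_mult_index[OF car Suc(1) B] by simp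
    qed }
  { case 2
    then show ?case using upper_triangular_mult_index[OF car Suc(1) B, of i i] Suc(2) by simp }
qed

text \<open>Induction on the distance \<open>j - i\<close> from the diagonal: once the closer
  entries of column \<open>j\<close> vanish, the entry of \<open>B ^ k\<close> at
  \<open>(i, j)\<close> is \<open>k\<close> times that of \<open>B\<close>. Taking
  \<open>k = m\<close> makes it zero, since the scalars have characteristic 0.\<close>

lemma unipotent_finite_order:
  assumes B: "(B :: complex mat) \<in> carrier_mat n n" "upper_triangular B"
    and diag: "\<And>i. i < n \<Longrightarrow> B $$ (i, i) = 1"
    and m: "m > 0" "B ^\<^sub>m m = 1\<^sub>m n"
  shows "B = 1\<^sub>m n"
proof -
  have off: "B $$ (i, j) = 0" if "i < j" "j < n" for i j
    using that
  proof (induction "j - i" arbitrary: i j rule: less_induct)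
    case less
    have i: "i < n" using less.prems by simp
    have zero: "B $$ (l, j) = 0" if "i < l" "l < j" for l
      using less.hyps[of j l] that less.prems by simp
    have "(B ^\<^sub>m k) $$ (i, j) = of_nat k * B $$ (i, j)" for k
    proof (induction k)
      case 0
      then show ?case using B less.prems by simp
    next
      case (Suc k)
      have car: "B ^\<^sub>m k \<in> carrier_mat n n" using B by simp
      have "(B ^\<^sub>m Suc k) $$ (i, j) = (\<Sum>l = i..j. (B ^\<^sub>m k) $$ (i, l) * B $$ (l, j))"
        using upper_triangular_mult_index[OF car upper_triangular_pow(1)[OF B] B i less.prems(2)] by simp
      \<comment> \<open>For \<open>l\<close> strictly between, \<open>B $$ (l, j)\<close> vanishes
        by the induction on the distance.\<close>
      also have "\<dots> = (\<Sum>l \<in> {i, j}. (B ^\<^sub>m k) $$ (i, l) * B $$ (l, j))"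
        using less.prems zero by (intro sum.mono_neutral_right) auto
      also have "\<dots> = B $$ (i, j) + of_nat k * B $$ (i, j)"
        using less.prems i diag upper_triangular_pow(2)[OF B i] Suc by simp
      finally show ?case by (simp add: algebra_simps)
    qed
    from this[of m] have "of_nat m * B $$ (i, j) = 0"
      using m(2) less.prems by simp
    then show ?case using m(1) by simp
  qed
  show ?thesis
  proof (rule eq_matI)
    fix i j assume ij: "i < dim_row (1\<^sub>m n :: complex mat)" "j < dim_col (1\<^sub>m n :: complex mat)"
    then consider "i = j" | "i < j" | "j < i" by linarith
    then show "B $$ (i, j) = 1\<^sub>m n $$ (i, j)"
      using ij off diag B by cases (auto simp: upper_triangular_def)
  qed (use B in auto)
qed

text \<open>Triangularize \<open>A\<close> by Schur. Finite order puts the diagonal entries on the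
  unit circle, and \<open>n\<close> real parts that are at most 1 can only add up to
  \<open>n\<close> if all equal 1. The triangular form is then unipotent of finite order, hence the
  identity.\<close>

lemma finite_order_trace_eq_dim:
  assumes A: "(A :: complex mat) \<in> carrier_mat n n" and m: "m > 0" "A ^\<^sub>m m = 1\<^sub>m n"
    and tr: "mat_trace A = of_nat n"
  shows "A = 1\<^sub>m n"
proof -
  obtain as where "char_poly A = (\<Prod>a\<leftarrow>as. [:- a, 1:])" using char_poly_factorized[OF A] by auto
  then obtain B where B: "B \<in> carrier_mat n n" "upper_triangular B" and "similar_mat A B"
    using schur_decomposition_exists[OF A] by blast
  then obtain P Q where sim: "similar_mat_wit A B P Q" unfolding similar_mat_def by blast
  have car: "P \<in> carrier_mat n n" "Q \<in> carrier_mat n n" and PQ: "P * Q = 1\<^sub>m n" "Q * P = 1\<^sub>m n" "A = P * B * Q"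
    using similar_mat_witD2[OF A sim] by auto
  have Bm: "B ^\<^sub>m m = 1\<^sub>m n"
  proof -
    have Bcar: "B ^\<^sub>m m \<in> carrier_mat n n" using B by simp
    have "P * (B ^\<^sub>m m) * Q = 1\<^sub>m n" using similar_mat_wit_pow_id[OF sim, of m] m(2) by simp
    then have "Q * (P * (B ^\<^sub>m m) * Q) * P = 1\<^sub>m n" using car PQ by simp
    moreover have "Q * (P * (B ^\<^sub>m m) * Q) * P = (Q * P) * (B ^\<^sub>m m) * (Q * P)"
      using car Bcar by (simp add: assoc_mult_mat[of _ n n _ n _ n])
    ultimately show ?thesis using PQ(2) left_mult_one_mat[OF Bcar] right_mult_one_mat[OF Bcar] by simp
  qed
  have norm: "cmod (B $$ (i, i)) = 1" if "i < n" for i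
  proof -
    have "(B $$ (i, i)) ^ m = 1" using upper_triangular_pow(2)[OF B that, of m] Bm that by simp
    then have "cmod (B $$ (i, i)) ^ m = 1" by (metis norm_one norm_power)
    then show ?thesis using m(1) power_eq_imp_eq_base[of "cmod (B $$ (i, i))" m 1] by simp
  qed
  have "mat_trace B = of_nat n" using mat_trace_similar[OF sim] tr by (rule trans[OF sym])
  then have "(\<Sum>i<n. B $$ (i, i)) = of_nat n" using B(1) by (simp add: mat_trace_def)
  then have "Re (\<Sum>i<n. B $$ (i, i)) = of_nat n" by simp
  then have "(\<Sum>i<n. 1 - Re (B $$ (i, i))) = 0"
    unfolding Re_sum by (simp add: sum_subtractf)
  moreover have le: "1 - Re (B $$ (i, i)) \<ge> 0" if "i < n" for i
    using norm[OF that] complex_Re_le_cmod[of "B $$ (i, i)"] by simp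
  ultimately have "1 - Re (B $$ (i, i)) = 0" if "i < n" for i
    using sum_nonneg_eq_0_iff[of "{..<n}" "\<lambda>i. 1 - Re (B $$ (i, i))"] that by auto
  \<comment> \<open>Modulus 1 and real part 1 leave no imaginary part.\<close>
  then have "B $$ (i, i) = 1" if "i < n" for i
    using norm[OF that] that by (intro complex_eqI) (auto simp: cmod_def)
  then have "B = 1\<^sub>m n" using unipotent_finite_order[OF B _ m(1) Bm] by blast
  then show ?thesis using PQ(1,3) right_mult_one_mat[OF car(1)] by metis
qed

section \<open>Kernels of representations, linear representations and twists\<close>

definition rep_ker :: "('a, 'b) monoid_scheme \<Rightarrow> nat \<Rightarrow> ('a \<Rightarrow> complex mat) \<Rightarrow> 'a set" where
  "rep_ker G n \<rho> = {g \<in> carrier G. \<rho> g = 1\<^sub>m n}"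

lemma is_repD:
  assumes "is_rep G n \<rho>"
  shows "g \<in> carrier G \<Longrightarrow> \<rho> g \<in> carrier_mat n n"
    "g \<in> carrier G \<Longrightarrow> h \<in> carrier G \<Longrightarrow> \<rho> (g \<otimes>\<^bsub>G\<^esub> h) = \<rho> g * \<rho> h"
    "\<rho> \<one>\<^bsub>G\<^esub> = 1\<^sub>m n"
  using assms by (auto simp: is_rep_def)

lemma (in group) rep_pow:
  assumes "is_rep G n \<rho>" "g \<in> carrier G"
  shows "\<rho> (g [^] (k :: nat)) = \<rho> g ^\<^sub>m k"
proof (induction k)
  case 0
  show ?case using is_repD(1)[OF assms] is_repD(3)[OF assms(1)] by simp
next
  case (Suc k)
  then show ?case using is_repD(2)[OF assms(1) nat_pow_closed[OF assms(2)] assms(2)] by simp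
qed

text \<open>Each \<open>\<rho> g\<close> has finite order, dividing the order of the group, so trace
  \<open>n\<close> forces the identity matrix. From here on kernels of homomorphisms replace the
  trace condition.\<close>

lemma (in group) char_ker_rep:
  assumes fin: "finite (carrier G)" and \<rho>: "is_rep G n \<rho>"
  shows "char_ker G (\<lambda>g\<in>carrier G. mat_trace (\<rho> g)) = rep_ker G n \<rho>"
proof -
  have one: "mat_trace (1\<^sub>m n) = of_nat n" by (simp add: mat_trace_def)
  have "mat_trace (\<rho> g) = of_nat n \<longleftrightarrow> \<rho> g = 1\<^sub>m n" if g: "g \<in> carrier G" for g
  proof
    assume "mat_trace (\<rho> g) = of_nat n"
    moreover have "\<rho> g ^\<^sub>m Coset.order G = 1\<^sub>m n"
      using rep_pow[OF \<rho> g, of "Coset.order G"] pow_order_eq_1[OF g] is_repD(3)[OF \<rho>] by simp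
    ultimately show "\<rho> g = 1\<^sub>m n"
      using finite_order_trace_eq_dim is_repD(1)[OF \<rho> g] order_gt_0_iff_finite fin by blast
  qed (simp add: one)
  then show ?thesis using is_repD(3)[OF \<rho>] by (auto simp: char_ker_def rep_ker_def one)
qed

lemma (in group) rep_ker_normal:
  assumes \<rho>: "is_rep G n \<rho>"
  shows "rep_ker G n \<rho> \<lhd> G"
proof (rule normal_invI)
  note R = is_repD[OF \<rho>]
  have inv: "\<rho> (inv g) = 1\<^sub>m n" if "g \<in> carrier G" "\<rho> g = 1\<^sub>m n" for g
    using R(1)[of "inv g"] R(2)[of "inv g" g] R(3) that by simp
  show "subgroup (rep_ker G n \<rho>) G"
    using R inv by (intro subgroupI) (auto simp: rep_ker_def)
  fix x h assume x: "x \<in> carrier G" and h: "h \<in> rep_ker G n \<rho>"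
  then have "\<rho> (x \<otimes> h \<otimes> inv x) = \<rho> x * 1\<^sub>m n * \<rho> (inv x)"
    using R(2) by (simp add: rep_ker_def)
  also have "\<dots> = \<rho> (x \<otimes> inv x)" using x R(2)[of x "inv x"] right_mult_one_mat[OF R(1)[OF x]] by simp
  finally have "\<rho> (x \<otimes> h \<otimes> inv x) = 1\<^sub>m n" using x R(3) by simp
  then show "x \<otimes> h \<otimes> inv x \<in> rep_ker G n \<rho>" using x h by (simp add: rep_ker_def)
qed

text \<open>Trivial commutators make the matrices commute, so an eigenspace of one is invariant
  under all and hence is the whole space. All matrices are then scalar, every line is invariant, and
  irreducibility leaves dimension 1.\<close>

lemma (in group) irr_rep_derived_trivial_dim:
  assumes irr: "irr_rep G n \<rho>" and D: "derived G (carrier G) \<subseteq> rep_ker G n \<rho>"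
  shows "n = 1"
proof -
  have \<rho>: "is_rep G n \<rho>" and n: "n > 0"
    and irred: "\<And>W. is_subspace n W \<Longrightarrow> \<forall>g\<in>carrier G. \<forall>v\<in>W. \<rho> g *\<^sub>v v \<in> W \<Longrightarrow> W = {0\<^sub>v n} \<or> W = carrier_vec n"
    using irr by (auto simp: irr_rep_def)
  note R = is_repD[OF \<rho>]
  have comm: "\<rho> x * \<rho> y = \<rho> y * \<rho> x" if xy: "x \<in> carrier G" "y \<in> carrier G" for x y
  proof -
    have c: "x \<otimes> y \<otimes> inv x \<otimes> inv y \<in> derived G (carrier G)"
      using xy by (rule commutator_in_derived)
    have "x \<otimes> y = (x \<otimes> y \<otimes> inv x \<otimes> inv y) \<otimes> (y \<otimes> x)"
      using xy by (rule mult_eq_commutator_mult)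
    then have "\<rho> (x \<otimes> y) = \<rho> (x \<otimes> y \<otimes> inv x \<otimes> inv y) * \<rho> (y \<otimes> x)"
      using R(2)[of "x \<otimes> y \<otimes> inv x \<otimes> inv y" "y \<otimes> x"] xy by simp
    also have "\<dots> = \<rho> (y \<otimes> x)" using c D R(1)[of "y \<otimes> x"] xy by (auto simp: rep_ker_def)
    finally show ?thesis using R(2) xy by simp
  qed
  have scalar: "\<exists>k. \<forall>w\<in>carrier_vec n. \<rho> x *\<^sub>v w = k \<cdot>\<^sub>v w" if x: "x \<in> carrier G" for x
  proof -
    obtain k where "eigenvalue (\<rho> x) k"
      using spectrum_non_empty[OF R(1)[OF x] n] by (auto simp: spectrum_def)
    then obtain v where v: "v \<in> carrier_vec n" "v \<noteq> 0\<^sub>v n" "\<rho> x *\<^sub>v v = k \<cdot>\<^sub>v v"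
      using R(1)[OF x] by (auto simp: eigenvalue_def eigenvector_def)
    \<comment> \<open>The eigenspace of \<open>\<rho> x\<close> for the eigenvalue
      \<open>k\<close>.\<close>
    define W where "W = {w \<in> carrier_vec n. \<rho> x *\<^sub>v w = k \<cdot>\<^sub>v w}"
    have "is_subspace n W"
      using R(1)[OF x] unfolding is_subspace_def W_def
      by (auto simp: mult_add_distrib_mat_vec smult_add_distrib_vec mult_mat_vec smult_smult_assoc mult.commute)
    moreover have "\<forall>g\<in>carrier G. \<forall>v\<in>W. \<rho> g *\<^sub>v v \<in> W"
    proof (intro ballI)
      fix g w assume g: "g \<in> carrier G" and w: "w \<in> W"
      have wc: "w \<in> carrier_vec n" using w by (simp add: W_def)
      have "\<rho> x *\<^sub>v (\<rho> g *\<^sub>v w) = (\<rho> x * \<rho> g) *\<^sub>v w"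
        using assoc_mult_mat_vec[OF R(1)[OF x] R(1)[OF g] wc] by simp
      also have "\<dots> = \<rho> g *\<^sub>v (\<rho> x *\<^sub>v w)"
        using comm[OF x g] assoc_mult_mat_vec[OF R(1)[OF g] R(1)[OF x] wc] by simp
      also have "\<dots> = k \<cdot>\<^sub>v (\<rho> g *\<^sub>v w)" using w mult_mat_vec[OF R(1)[OF g] wc] by (simp add: W_def)
      finally show "\<rho> g *\<^sub>v w \<in> W" using w R(1)[OF g] by (simp add: W_def)
    qed
    moreover have "v \<in> W" using v by (simp add: W_def)
    ultimately have "W = carrier_vec n" using irred v(2) by blast
    then show ?thesis unfolding W_def by blast
  qed
  \<comment> \<open>An invariant line; irreducibility makes it the whole space.\<close>
  define W where "W = {c \<cdot>\<^sub>v unit_vec n 0 | c :: complex. True}"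
  have "is_subspace n W"
    unfolding is_subspace_def W_def
  proof (intro conjI ballI allI)
    show "0\<^sub>v n \<in> {c \<cdot>\<^sub>v unit_vec n 0 | c :: complex. True}"
      by (intro CollectI exI[of _ 0]) auto
  next
    fix v w assume "v \<in> {c \<cdot>\<^sub>v unit_vec n 0 | c :: complex. True}" "w \<in> {c \<cdot>\<^sub>v unit_vec n 0 | c :: complex. True}"
    then show "v + w \<in> {c \<cdot>\<^sub>v unit_vec n 0 | c :: complex. True}"
      by (auto simp flip: add_smult_distrib_vec)
  next
    fix v and c :: complex assume "v \<in> {c \<cdot>\<^sub>v unit_vec n 0 | c :: complex. True}"
    then show "c \<cdot>\<^sub>v v \<in> {c \<cdot>\<^sub>v unit_vec n 0 | c :: complex. True}"
      by (auto simp: smult_smult_assoc)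
  qed auto
  moreover have "\<forall>g\<in>carrier G. \<forall>v\<in>W. \<rho> g *\<^sub>v v \<in> W"
  proof (intro ballI)
    fix g v assume "g \<in> carrier G" "v \<in> W"
    moreover from this obtain k where "\<forall>w\<in>carrier_vec n. \<rho> g *\<^sub>v w = k \<cdot>\<^sub>v w" using scalar by blast
    ultimately show "\<rho> g *\<^sub>v v \<in> W" by (auto simp: W_def smult_smult_assoc)
  qed
  moreover have "unit_vec n 0 \<in> W" unfolding W_def by (intro CollectI exI[of _ 1]) auto
  then have "W \<noteq> {0\<^sub>v n}" using n by (auto dest!: arg_cong[where f = "\<lambda>v. v $ 0"])
  ultimately have W: "W = carrier_vec n" using irred by blast
  show "n = 1"
  proof (rule ccontr)
    assume "n \<noteq> 1"
    then have n1: "1 < n" using n by simp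
    have "unit_vec n 1 \<in> W" using W by simp
    then obtain c :: complex where "unit_vec n 1 = c \<cdot>\<^sub>v unit_vec n 0" unfolding W_def by blast
    then have "(unit_vec n 1 :: complex vec) $ 1 = (c \<cdot>\<^sub>v unit_vec n 0) $ 1" by simp
    then show False using n1 by simp
  qed
qed

text \<open>The tensor product with a linear representation multiplies each matrix by a nonzero
  scalar, which does not change the invariant subspaces.\<close>

lemma (in group) irr_rep_twist:
  assumes irr: "irr_rep G n \<rho>" and lin: "is_rep G 1 \<sigma>"
  shows "irr_rep G n (\<lambda>g. \<sigma> g $$ (0, 0) \<cdot>\<^sub>m \<rho> g)"
proof -
  have \<rho>: "is_rep G n \<rho>" and n: "n > 0"
    and irred: "\<And>W. is_subspace n W \<Longrightarrow> \<forall>g\<in>carrier G. \<forall>v\<in>W. \<rho> g *\<^sub>v v \<in> W \<Longrightarrow> W = {0\<^sub>v n} \<or> W = carrier_vec n"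
    using irr by (auto simp: irr_rep_def)
  note R = is_repD[OF \<rho>] and S = is_repD[OF lin]
  let ?c = "\<lambda>g. \<sigma> g $$ (0, 0)"
  have c_mult: "?c (g \<otimes> h) = ?c g * ?c h" if "g \<in> carrier G" "h \<in> carrier G" for g h
    using S(1)[OF that(1)] S(1)[OF that(2)] S(2)[OF that] by (simp add: scalar_prod_def)
  have c_one: "?c \<one> = 1" using S(3) by simp
  have c_nz: "?c g \<noteq> 0" if "g \<in> carrier G" for g
    using c_mult[of g "inv g"] c_one that by auto
  have "is_rep G n (\<lambda>g. ?c g \<cdot>\<^sub>m \<rho> g)"
    unfolding is_rep_def
  proof (intro conjI ballI)
    fix g h assume gh: "g \<in> carrier G" "h \<in> carrier G"
    have "(?c g \<cdot>\<^sub>m \<rho> g) * (?c h \<cdot>\<^sub>m \<rho> h) = ?c g \<cdot>\<^sub>m (?c h \<cdot>\<^sub>m (\<rho> g * \<rho> h))"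
      using mult_smult_assoc_mat[OF R(1)[OF gh(1)], of "?c h \<cdot>\<^sub>m \<rho> h" n "?c g"]
        mult_smult_distrib[OF R(1)[OF gh(1)] R(1)[OF gh(2)], of "?c h"] R(1)[OF gh(2)]
      by simp
    also have "\<dots> = (?c g * ?c h) \<cdot>\<^sub>m (\<rho> g * \<rho> h)"
      using R(1)[OF gh(1)] R(1)[OF gh(2)] by (intro eq_matI) auto
    finally have "(?c g \<cdot>\<^sub>m \<rho> g) * (?c h \<cdot>\<^sub>m \<rho> h) = (?c g * ?c h) \<cdot>\<^sub>m (\<rho> g * \<rho> h)" .
    then show "?c (g \<otimes> h) \<cdot>\<^sub>m \<rho> (g \<otimes> h) = (?c g \<cdot>\<^sub>m \<rho> g) * (?c h \<cdot>\<^sub>m \<rho> h)"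
      using c_mult[OF gh] R(2)[OF gh] by simp
  next
    show "?c \<one> \<cdot>\<^sub>m \<rho> \<one> = 1\<^sub>m n" using c_one R(3) by auto
  qed (use R in simp)
  moreover have "W = {0\<^sub>v n} \<or> W = carrier_vec n"
    if W: "is_subspace n W" "\<forall>g\<in>carrier G. \<forall>v\<in>W. (?c g \<cdot>\<^sub>m \<rho> g) *\<^sub>v v \<in> W" for W
  proof (rule irred[OF W(1)], intro ballI)
    fix g v assume g: "g \<in> carrier G" and v: "v \<in> W"
    have vc: "v \<in> carrier_vec n" using W(1) v by (auto simp: is_subspace_def)
    have "(1 / ?c g) \<cdot>\<^sub>v ((?c g \<cdot>\<^sub>m \<rho> g) *\<^sub>v v) \<in> W"
      using W g v by (auto simp: is_subspace_def)
    moreover have "(1 / ?c g) \<cdot>\<^sub>v ((?c g \<cdot>\<^sub>m \<rho> g) *\<^sub>v v) = \<rho> g *\<^sub>v v"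
      using c_nz[OF g] R(1)[OF g] vc by (intro eq_vecI) auto
    ultimately show "\<rho> g *\<^sub>v v \<in> W" by simp
  qed
  ultimately show ?thesis using n by (auto simp: irr_rep_def)
qed

section \<open>Matrix representations on invariant subspaces\<close>

lemma mat_eqI_mult_vec:
  assumes A: "(A :: complex mat) \<in> carrier_mat n n" and B: "B \<in> carrier_mat n n"
    and eq: "\<And>v. v \<in> carrier_vec n \<Longrightarrow> A *\<^sub>v v = B *\<^sub>v v"
  shows "A = B"
proof (rule eq_matI)
  fix i j assume ij: "i < dim_row B" "j < dim_col B"
  have "(A *\<^sub>v unit_vec n j) $ i = (B *\<^sub>v unit_vec n j) $ i" using eq by simp
  then show "A $$ (i, j) = B $$ (i, j)" using A B ij by simp
qed (use A B in auto)

text \<open>The action lives on a subspace \<open>V\<close> of an ambient space rather than on a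
  whole type, so that restricting to an invariant subspace yields another instance with the same
  \<open>act\<close>.\<close>

locale linear_action = group G + vector_space scale
  for G (structure) and scale :: "complex \<Rightarrow> 'v :: ab_group_add \<Rightarrow> 'v" +
  fixes act :: "'a \<Rightarrow> 'v \<Rightarrow> 'v" and V :: "'v set"
  assumes subspace_V: "subspace V"
    and finite_dim: "\<exists>T. finite T \<and> V \<subseteq> span T"
    and act_closed: "g \<in> carrier G \<Longrightarrow> v \<in> V \<Longrightarrow> act g v \<in> V"
    and act_add: "g \<in> carrier G \<Longrightarrow> v \<in> V \<Longrightarrow> w \<in> V \<Longrightarrow> act g (v + w) = act g v + act g w"
    and act_scale: "g \<in> carrier G \<Longrightarrow> v \<in> V \<Longrightarrow> act g (scale c v) = scale c (act g v)"
    and act_mult: "g \<in> carrier G \<Longrightarrow> h \<in> carrier G \<Longrightarrow> v \<in> V \<Longrightarrow> act (g \<otimes> h) v = act g (act h v)"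
    and act_one: "v \<in> V \<Longrightarrow> act \<one> v = v"
begin

definition invariant :: "'v set \<Rightarrow> bool" where
  "invariant U \<longleftrightarrow> (\<forall>g\<in>carrier G. \<forall>u\<in>U. act g u \<in> U)"

lemma linear_action_subspace:
  assumes "subspace U" "U \<subseteq> V" "invariant U"
  shows "linear_action G scale act U"
proof unfold_locales
  show "\<exists>T. finite T \<and> U \<subseteq> span T" using finite_dim assms(2) by blast
qed (use assms act_add act_scale act_mult act_one in \<open>auto simp: invariant_def subset_iff\<close>)

lemma act_0: "g \<in> carrier G \<Longrightarrow> act g 0 = 0"
  using act_scale[of g 0 0] subspace_0[OF subspace_V] by simp

lemma act_diff: "g \<in> carrier G \<Longrightarrow> v \<in> V \<Longrightarrow> w \<in> V \<Longrightarrow> act g (v - w) = act g v - act g w"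
  using act_add[of g "v - w" w] subspace_diff[OF subspace_V] by (simp add: eq_diff_eq)

lemma act_sum:
  assumes "g \<in> carrier G" "\<And>i. i \<in> I \<Longrightarrow> f i \<in> V"
  shows "act g (sum f I) = (\<Sum>i\<in>I. act g (f i))"
  using assms(2)
  by (induction I rule: infinite_finite_induct)
    (simp_all add: act_0 act_add assms(1) subspace_sum[OF subspace_V])

text \<open>A basis of \<open>V\<close> turns the action into matrices, the form that
  \<open>irr_rep\<close> demands. Coordinates match invariant subspaces on both sides, and the group
  elements acting trivially are the same.\<close>

lemma irr_rep_of_irreducible:
  assumes ne: "V \<noteq> {0}"
    and irred: "\<And>U. subspace U \<Longrightarrow> U \<subseteq> V \<Longrightarrow> invariant U \<Longrightarrow> U = {0} \<or> U = V"
  shows "\<exists>n \<rho>. irr_rep G n \<rho> \<and> (\<forall>g\<in>carrier G. \<rho> g = 1\<^sub>m n \<longleftrightarrow> (\<forall>v\<in>V. act g v = v))"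
proof -
  obtain B where B: "B \<subseteq> V" "independent B" "V \<subseteq> span B" "card B = dim V" by (rule basis_exists)
  obtain T where T: "finite T" "V \<subseteq> span T" using finite_dim by blast
  have finB: "finite B" using independent_span_bound[OF T(1) B(2)] B(1) T(2) by blast
  have spanB: "span B = V" using span_minimal[OF B(1) subspace_V] B(3) by blast
  define n where "n = card B"
  obtain b where b: "bij_betw b {..<n} B"
    using ex_bij_betw_nat_finite[OF finB] unfolding n_def lessThan_atLeast0 by blast
  have bB: "b i \<in> B" if "i < n" for i using b that by (auto simp: bij_betw_def)
  have bV: "b i \<in> V" if "i < n" for i using bB B(1) that by blast
  have b_inj: "b i = b j \<longleftrightarrow> i = j" if "i < n" "j < n" for i j
    using b that by (auto simp: bij_betw_def inj_on_def)
  \<comment> \<open>\<open>\<phi>\<close> builds a vector from its coordinates and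
    \<open>\<psi>\<close> reads them off; the two are mutually inverse between
    \<open>carrier_vec n\<close> and \<open>V\<close>.\<close>
  define \<phi> where "\<phi> u = (\<Sum>i<n. scale (u $ i) (b i))" for u :: "complex vec"
  define \<psi> where "\<psi> v = vec n (\<lambda>i. representation B v (b i))" for v
  have \<phi>V: "\<phi> u \<in> V" for u
    unfolding \<phi>_def using bV by (intro subspace_sum[OF subspace_V] subspace_scale[OF subspace_V]) auto
  have \<psi>_car: "\<psi> v \<in> carrier_vec n" for v by (simp add: \<psi>_def)
  have \<phi>\<psi>: "\<phi> (\<psi> v) = v" if "v \<in> V" for v
  proof -
    have "\<phi> (\<psi> v) = (\<Sum>i<n. scale (representation B v (b i)) (b i))" by (simp add: \<phi>_def \<psi>_def)
    also have "\<dots> = (\<Sum>x\<in>B. scale (representation B v x) x)"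
      using sum.reindex_bij_betw[OF b, of "\<lambda>x. scale (representation B v x) x"] .
    also have "\<dots> = v" using sum_representation_eq[OF B(2) _ finB] that spanB by simp
    finally show ?thesis .
  qed
  have \<psi>\<phi>: "\<psi> (\<phi> u) = u" if u: "u \<in> carrier_vec n" for u
  proof (rule eq_vecI)
    fix i assume "i < dim_vec u"
    then have i: "i < n" using u by simp
    have "representation B (\<phi> u) (b i) = (\<Sum>j<n. representation B (scale (u $ j) (b j)) (b i))"
      unfolding \<phi>_def using bB by (subst representation_sum[OF B(2)]) (auto intro: span_scale span_base)
    also have "\<dots> = (\<Sum>j<n. if j = i then u $ j else 0)"
      using bB b_inj i by (intro sum.cong refl)
        (auto simp: representation_scale[OF B(2)] representation_basis[OF B(2)] span_base)
    also have "\<dots> = u $ i" using i by simp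
    finally show "\<psi> (\<phi> u) $ i = u $ i" using i by (simp add: \<psi>_def)
  qed (use u in \<open>simp add: \<psi>_def\<close>)
  have \<phi>_add: "\<phi> (u + w) = \<phi> u + \<phi> w" if "u \<in> carrier_vec n" "w \<in> carrier_vec n" for u w
    using that by (simp add: \<phi>_def scale_left_distrib sum.distrib)
  have \<phi>_scale: "\<phi> (c \<cdot>\<^sub>v u) = scale c (\<phi> u)" if "u \<in> carrier_vec n" for c u
    using that by (simp add: \<phi>_def scale_sum_right)
  \<comment> \<open>Column \<open>j\<close> holds the coordinates of the image of the basis vector
    \<open>b j\<close>.\<close>
  define \<rho> where "\<rho> g = mat n n (\<lambda>(i, j). representation B (act g (b j)) (b i))" for g
  have \<rho>_car: "\<rho> g \<in> carrier_mat n n" for g by (simp add: \<rho>_def)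
  have intertwine: "\<phi> (\<rho> g *\<^sub>v u) = act g (\<phi> u)" if g: "g \<in> carrier G" and u: "u \<in> carrier_vec n" for g u
  proof -
    have "\<phi> (\<rho> g *\<^sub>v u) = (\<Sum>i<n. \<Sum>j<n. scale (u $ j) (scale (representation B (act g (b j)) (b i)) (b i)))"
      unfolding \<phi>_def using u
      by (intro sum.cong refl)
        (simp add: \<rho>_def scalar_prod_def lessThan_atLeast0 scale_sum_left mult.commute)
    also have "\<dots> = (\<Sum>j<n. scale (u $ j) (\<Sum>i<n. scale (representation B (act g (b j)) (b i)) (b i)))"
      by (subst sum.swap) (simp add: scale_sum_right)
    also have "\<dots> = (\<Sum>j<n. scale (u $ j) (act g (b j)))"
    proof (intro sum.cong refl)
      fix j assume "j \<in> {..<n}"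
      then have "act g (b j) \<in> V" using act_closed g bV by simp
      then have "(\<Sum>i<n. scale (representation B (act g (b j)) (b i)) (b i)) = act g (b j)"
        using \<phi>\<psi>[of "act g (b j)"] by (simp add: \<phi>_def \<psi>_def)
      then show "scale (u $ j) (\<Sum>i<n. scale (representation B (act g (b j)) (b i)) (b i)) = scale (u $ j) (act g (b j))"
        by simp
    qed
    also have "\<dots> = act g (\<phi> u)"
      unfolding \<phi>_def using g bV
      by (subst act_sum) (auto simp: act_scale subspace_scale[OF subspace_V])
    finally show ?thesis .
  qed
  have \<phi>_inj: "u = w" if "\<phi> u = \<phi> w" "u \<in> carrier_vec n" "w \<in> carrier_vec n" for u w
    using \<psi>\<phi> that by metis
  have rep: "is_rep G n \<rho>"
    unfolding is_rep_def
  proof (intro conjI ballI)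
    fix g h assume gh: "g \<in> carrier G" "h \<in> carrier G"
    show "\<rho> (g \<otimes> h) = \<rho> g * \<rho> h"
    proof (rule mat_eqI_mult_vec)
      fix u :: "complex vec" assume u: "u \<in> carrier_vec n"
      have hu: "\<rho> h *\<^sub>v u \<in> carrier_vec n" using mult_mat_vec_carrier[OF \<rho>_car u] .
      have "\<phi> (\<rho> (g \<otimes> h) *\<^sub>v u) = \<phi> (\<rho> g *\<^sub>v (\<rho> h *\<^sub>v u))"
        using intertwine gh u hu act_mult \<phi>V by simp
      then have "\<rho> (g \<otimes> h) *\<^sub>v u = \<rho> g *\<^sub>v (\<rho> h *\<^sub>v u)"
        using \<phi>_inj mult_mat_vec_carrier[OF \<rho>_car] u hu by blast
      then show "\<rho> (g \<otimes> h) *\<^sub>v u = \<rho> g * \<rho> h *\<^sub>v u"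
        using assoc_mult_mat_vec[OF \<rho>_car \<rho>_car u] by simp
    qed (use \<rho>_car mult_carrier_mat[OF \<rho>_car \<rho>_car] in auto)
  next
    show "\<rho> \<one> = 1\<^sub>m n"
    proof (rule mat_eqI_mult_vec)
      fix u :: "complex vec" assume u: "u \<in> carrier_vec n"
      then have "\<phi> (\<rho> \<one> *\<^sub>v u) = \<phi> u" using intertwine act_one \<phi>V by simp
      then show "\<rho> \<one> *\<^sub>v u = 1\<^sub>m n *\<^sub>v u"
        using \<phi>_inj[OF _ mult_mat_vec_carrier[OF \<rho>_car u] u] u by simp
    qed (use \<rho>_car in auto)
  qed (rule \<rho>_car)
  have npos: "n > 0"
  proof (rule ccontr)
    assume "\<not> n > 0"
    then have "B = {}" using finB by (simp add: n_def)
    then show False using spanB ne by simp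
  qed
  have \<phi>0: "\<phi> (0\<^sub>v n) = 0" by (simp add: \<phi>_def)
  have "W = {0\<^sub>v n} \<or> W = carrier_vec n"
    if W: "is_subspace n W" "\<forall>g\<in>carrier G. \<forall>v\<in>W. \<rho> g *\<^sub>v v \<in> W" for W
  proof -
    have Wc: "W \<subseteq> carrier_vec n" "0\<^sub>v n \<in> W"
      and Wadd: "\<And>v w. v \<in> W \<Longrightarrow> w \<in> W \<Longrightarrow> v + w \<in> W"
      and Wsc: "\<And>c v. v \<in> W \<Longrightarrow> c \<cdot>\<^sub>v v \<in> W"
      using W(1) by (auto simp: is_subspace_def)
    \<comment> \<open>An invariant \<open>W\<close> is carried into \<open>V\<close>, where
      irreducibility of the action applies.\<close>
    have "subspace (\<phi> ` W)"
    proof (rule subspaceI)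
      show "0 \<in> \<phi> ` W" using \<phi>0 Wc(2) by force
      fix x y assume "x \<in> \<phi> ` W" "y \<in> \<phi> ` W"
      then obtain u w where "u \<in> W" "w \<in> W" "x = \<phi> u" "y = \<phi> w" by blast
      then show "x + y \<in> \<phi> ` W" using \<phi>_add[of u w] Wadd[of u w] Wc(1) by (metis imageI subsetD)
    next
      fix c x assume "x \<in> \<phi> ` W"
      then obtain u where "u \<in> W" "x = \<phi> u" by blast
      then show "scale c x \<in> \<phi> ` W" using \<phi>_scale[of u c] Wsc[of u c] Wc(1) by (metis imageI subsetD)
    qed
    moreover have "\<phi> ` W \<subseteq> V" using \<phi>V by blast
    moreover have "invariant (\<phi> ` W)"
      unfolding invariant_def
    proof (intro ballI)
      fix g x assume g: "g \<in> carrier G" and "x \<in> \<phi> ` W"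
      then obtain u where u: "u \<in> W" "x = \<phi> u" by blast
      then have "act g x = \<phi> (\<rho> g *\<^sub>v u)" using intertwine[OF g, of u] Wc(1) by auto
      then show "act g x \<in> \<phi> ` W" using W(2) g u(1) by blast
    qed
    ultimately have "\<phi> ` W = {0} \<or> \<phi> ` W = V" by (rule irred)
    then show ?thesis
    proof
      assume im: "\<phi> ` W = {0}"
      have "u = 0\<^sub>v n" if "u \<in> W" for u
        using \<phi>_inj[of u "0\<^sub>v n"] \<phi>0 that im Wc by auto
      then show ?thesis using Wc(2) by blast
    next
      assume im: "\<phi> ` W = V"
      have "u \<in> W" if u: "u \<in> carrier_vec n" for u
      proof -
        obtain w where "w \<in> W" "\<phi> u = \<phi> w" using im \<phi>V[of u] by blast
        then show ?thesis using \<phi>_inj[of u w] u Wc(1) by blast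
      qed
      then show ?thesis using Wc(1) by blast
    qed
  qed
  then have "irr_rep G n \<rho>" using rep npos by (auto simp: irr_rep_def)
  moreover have "\<rho> g = 1\<^sub>m n \<longleftrightarrow> (\<forall>v\<in>V. act g v = v)" if g: "g \<in> carrier G" for g
  proof
    assume one: "\<rho> g = 1\<^sub>m n"
    show "\<forall>v\<in>V. act g v = v"
    proof
      fix v assume "v \<in> V"
      then show "act g v = v" using intertwine[OF g \<psi>_car, of v] \<phi>\<psi>[of v] one \<psi>_car[of v] by simp
    qed
  next
    assume triv: "\<forall>v\<in>V. act g v = v"
    show "\<rho> g = 1\<^sub>m n"
    proof (rule mat_eqI_mult_vec)
      fix u :: "complex vec" assume u: "u \<in> carrier_vec n"
      then have "\<phi> (\<rho> g *\<^sub>v u) = \<phi> u" using intertwine[OF g u] triv \<phi>V by simp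
      then show "\<rho> g *\<^sub>v u = 1\<^sub>m n *\<^sub>v u"
        using \<phi>_inj[OF _ mult_mat_vec_carrier[OF \<rho>_car u] u] u by simp
    qed (use \<rho>_car in auto)
  qed
  ultimately show ?thesis by blast
qed

text \<open>Extend a basis of \<open>U\<close> to one of \<open>W\<close>. Both are finite because
  \<open>V\<close> has a finite spanning set, so counting makes them equal.\<close>

lemma subspace_eq_if_dim_le:
  assumes U: "subspace U" "U \<subseteq> W" and W: "subspace W" "W \<subseteq> V" and dim: "dim W \<le> dim U"
  shows "U = W"
proof -
  obtain BU where BU: "BU \<subseteq> U" "independent BU" "U \<subseteq> span BU" "card BU = dim U"
    by (rule basis_exists)
  have "BU \<subseteq> W" using BU(1) U(2) by blast
  then obtain B where B: "BU \<subseteq> B" "B \<subseteq> W" "independent B" "W \<subseteq> span B"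
    using BU(2) by (rule maximal_independent_subset_extend)
  obtain T where T: "finite T" "V \<subseteq> span T" using finite_dim by blast
  have "finite B" using independent_span_bound[OF T(1) B(3)] B(2) W(2) T(2) by blast
  moreover have "card B = dim W" using basis_card_eq_dim[OF B(2,4,3)] .
  ultimately have "BU = B" using card_seteq[of B BU] B(1) BU(4) dim by simp
  then show ?thesis using B(4) span_minimal[OF BU(1) U(1)] U(2) by blast
qed

text \<open>Take a nonzero invariant subspace of least dimension.\<close>

lemma exists_irreducible_invariant:
  assumes "V \<noteq> {0}"
  shows "\<exists>W. subspace W \<and> W \<subseteq> V \<and> invariant W \<and> W \<noteq> {0} \<and>
    (\<forall>U. subspace U \<longrightarrow> U \<subseteq> W \<longrightarrow> invariant U \<longrightarrow> U = {0} \<or> U = W)"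
proof -
  let ?P = "\<lambda>W. subspace W \<and> W \<subseteq> V \<and> invariant W \<and> W \<noteq> {0}"
  have "?P V" using assms subspace_V act_closed by (auto simp: invariant_def)
  then obtain W where W: "?P W" "\<And>U. ?P U \<Longrightarrow> dim W \<le> dim U"
    using ex_has_least_nat[of ?P V dim] by blast
  have "U = {0} \<or> U = W" if "subspace U" "U \<subseteq> W" "invariant U" for U
    using subspace_eq_if_dim_le[of U W] W that by blast
  then show ?thesis using W(1) by blast
qed

text \<open>The vectors fixed by \<open>N\<close> and annihilated by the sum over \<open>K\<close> form a nonzero invariant
  subspace: it contains \<open>act k v - v\<close>. A vector of it that is fixed by \<open>K\<close> is zero, so \<open>K\<close> acts nontrivially
  on each of its irreducible subspaces.\<close>

lemma exists_irr_rep_kernel: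
  assumes fin: "finite (carrier G)" and N: "N \<lhd> G" and K: "K \<lhd> G"
    and v: "v \<in> V" "\<And>x. x \<in> N \<Longrightarrow> act x v = v" and k: "k \<in> K" "act k v \<noteq> v"
  shows "\<exists>n \<rho>. irr_rep G n \<rho> \<and> N \<subseteq> rep_ker G n \<rho> \<and> \<not> K \<subseteq> rep_ker G n \<rho>"
proof -
  have NG: "x \<in> carrier G" if "x \<in> N" for x using subgroup.mem_carrier[OF normal_imp_subgroup[OF N] that] .
  have KG: "x \<in> carrier G" if "x \<in> K" for x using subgroup.mem_carrier[OF normal_imp_subgroup[OF K] that] .
  have finK: "finite K" using finite_subset[OF _ fin] KG by blast
  \<comment> \<open>Up to the factor \<open>card K\<close> this is the projection onto the vectors
    fixed by \<open>K\<close>.\<close>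
  define S where "S w = (\<Sum>x\<in>K. act x w)" for w
  define V0 where "V0 = {w \<in> V. (\<forall>x\<in>N. act x w = w) \<and> S w = 0}"
  have S_add: "S (u + w) = S u + S w" if "u \<in> V" "w \<in> V" for u w
    using that KG act_add by (simp add: S_def sum.distrib)
  have S_scale: "S (scale c w) = scale c (S w)" if "w \<in> V" for c w
    using that KG act_scale by (simp add: S_def scale_sum_right)
  have conj: "inv g \<otimes> x \<otimes> g \<in> M" if "M \<lhd> G" "x \<in> M" "g \<in> carrier G" for M x g
    using normal.inv_op_closed1[OF that(1,3,2)] .
  \<comment> \<open>From \<open>x g = g (inv g x g)\<close>: normality of a subgroup lets its
    elements be moved past \<open>g\<close>.\<close>
  have move: "act x (act g w) = act g (act (inv g \<otimes> x \<otimes> g) w)"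
    if "x \<in> carrier G" "g \<in> carrier G" "w \<in> V" for x g w
  proof -
    have "g \<otimes> (inv g \<otimes> x \<otimes> g) = x \<otimes> g" using that by (simp add: m_assoc mult_inv_cancel)
    then have "act (x \<otimes> g) w = act g (act (inv g \<otimes> x \<otimes> g) w)"
      using act_mult[of g "inv g \<otimes> x \<otimes> g" w] that by simp
    then show ?thesis using act_mult that by simp
  qed
  have S_act: "S (act g w) = act g (S w)" if g: "g \<in> carrier G" and w: "w \<in> V" for g w
  proof -
    have "bij_betw (\<lambda>x. inv g \<otimes> x \<otimes> g) K K"
    proof (rule bij_betw_byWitness[where f' = "\<lambda>x. g \<otimes> x \<otimes> inv g"])
      show "(\<lambda>x. g \<otimes> x \<otimes> inv g) ` K \<subseteq> K"
        using normal.inv_op_closed2[OF K g] by blast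
      show "(\<lambda>x. inv g \<otimes> x \<otimes> g) ` K \<subseteq> K" using conj[OF K _ g] by blast
      show "\<forall>x\<in>K. g \<otimes> (inv g \<otimes> x \<otimes> g) \<otimes> inv g = x"
        using KG g by (simp add: m_assoc mult_inv_cancel)
      show "\<forall>x\<in>K. inv g \<otimes> (g \<otimes> x \<otimes> inv g) \<otimes> g = x"
        using KG g by (simp add: m_assoc mult_inv_cancel)
    qed
    then have "S w = (\<Sum>x\<in>K. act (inv g \<otimes> x \<otimes> g) w)"
      unfolding S_def using sum.reindex_bij_betw[of _ K K "\<lambda>x. act x w"] by simp
    then have "act g (S w) = (\<Sum>x\<in>K. act g (act (inv g \<otimes> x \<otimes> g) w))"
      using KG g w act_closed by (simp add: act_sum)
    also have "\<dots> = S (act g w)" unfolding S_def by (rule sum.cong[OF refl]) (rule move[OF KG g w, symmetric])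
    finally show ?thesis by simp
  qed
  have sub: "subspace V0"
  proof (rule subspaceI)
    show "0 \<in> V0" using subspace_0[OF subspace_V] act_0 NG KG by (simp add: V0_def S_def)
    show "x + y \<in> V0" if "x \<in> V0" "y \<in> V0" for x y
      using that NG act_add S_add subspace_add[OF subspace_V] by (simp add: V0_def)
    show "scale c x \<in> V0" if "x \<in> V0" for c x
      using that NG act_scale S_scale subspace_scale[OF subspace_V] by (simp add: V0_def)
  qed
  have inv: "invariant V0"
    unfolding invariant_def
  proof (intro ballI)
    fix g w assume g: "g \<in> carrier G" and w: "w \<in> V0"
    then have wV: "w \<in> V" by (simp add: V0_def)
    have "act x (act g w) = act g w" if "x \<in> N" for x
      using move[OF NG[OF that] g wV] conj[OF N that g] w by (simp add: V0_def)
    moreover have "S (act g w) = 0" using S_act[OF g wV] w act_0[OF g] by (simp add: V0_def)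
    ultimately show "act g w \<in> V0" using act_closed[OF g wV] by (simp add: V0_def)
  qed
  have kG: "k \<in> carrier G" using KG k(1) .
  have kv: "act k v \<in> V" using act_closed kG v(1) .
  have "act k v - v \<in> V0"
  proof -
    have "act x (act k v) = act k v" if "x \<in> N" for x
      using move[OF NG[OF that] kG v(1)] conj[OF N that kG] v(2) by simp
    \<comment> \<open>Right translation by \<open>k\<close> permutes \<open>K\<close>, so
      \<open>S\<close> annihilates \<open>act k v - v\<close>.\<close>
    moreover have "S (act k v) = S v"
    proof -
      have "bij_betw (\<lambda>x. x \<otimes> k) K K"
      proof (rule bij_betw_byWitness[where f' = "\<lambda>x. x \<otimes> inv k"])
        have Ks: "subgroup K G" by (rule normal_imp_subgroup[OF K])
        show "(\<lambda>x. x \<otimes> k) ` K \<subseteq> K" using subgroup.m_closed[OF Ks _ k(1)] by blast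
        show "(\<lambda>x. x \<otimes> inv k) ` K \<subseteq> K"
          using subgroup.m_closed[OF Ks _ subgroup.m_inv_closed[OF Ks k(1)]] by blast
      qed (use KG kG in \<open>auto simp: m_assoc\<close>)
      then have "S v = (\<Sum>x\<in>K. act (x \<otimes> k) v)"
        unfolding S_def using sum.reindex_bij_betw[of _ K K "\<lambda>x. act x v"] by simp
      then show ?thesis using act_mult KG kG v(1) by (simp add: S_def)
    qed
    moreover have "S (act k v - v) = S (act k v) - S v"
      using KG kv v(1) act_diff by (simp add: S_def sum_subtractf)
    ultimately show ?thesis
      using NG kv v act_diff subspace_diff[OF subspace_V] by (simp add: V0_def)
  qed
  then have ne: "V0 \<noteq> {0}" using k(2) by auto
  interpret V0: linear_action G scale act V0
    using linear_action_subspace[OF sub _ inv] by (auto simp: V0_def)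
  obtain W where W: "subspace W" "W \<subseteq> V0" "invariant W" "W \<noteq> {0}"
    and irred: "\<And>U. subspace U \<Longrightarrow> U \<subseteq> W \<Longrightarrow> invariant U \<Longrightarrow> U = {0} \<or> U = W"
    using V0.exists_irreducible_invariant[OF ne] by blast
  interpret W: linear_action G scale act W
    using V0.linear_action_subspace[OF W(1-3)] .
  obtain n \<rho> where irr: "irr_rep G n \<rho>"
    and ker: "\<And>g. g \<in> carrier G \<Longrightarrow> \<rho> g = 1\<^sub>m n \<longleftrightarrow> (\<forall>v\<in>W. act g v = v)"
    using W.irr_rep_of_irreducible[OF W(4) irred] by blast
  have "N \<subseteq> rep_ker G n \<rho>" using NG ker W(2) by (auto simp: rep_ker_def V0_def)
  moreover have "\<not> K \<subseteq> rep_ker G n \<rho>"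
  proof
    assume "K \<subseteq> rep_ker G n \<rho>"
    then have triv: "act x w = w" if "x \<in> K" "w \<in> W" for x w
      using ker[OF KG[OF that(1)]] that by (auto simp: rep_ker_def)
    \<comment> \<open>On \<open>V0\<close> the sum is zero, while for a vector fixed by
      \<open>K\<close> it is \<open>card K\<close> times that vector.\<close>
    have "w = 0" if w: "w \<in> W" for w
    proof -
      have "(\<Sum>x\<in>K. scale 1 w) = 0" using triv[OF _ w] w W(2) by (auto simp: V0_def S_def)
      then have "scale (\<Sum>x\<in>K. 1) w = 0" by (simp only: scale_sum_left)
      moreover have "card K \<noteq> 0" using finK k(1) by auto
      ultimately show ?thesis by simp
    qed
    then show False using W(4) subspace_0[OF W(1)] by blast
  qed
  ultimately show ?thesis using irr by blast
qed

end

section \<open>The regular representation and nonlinear kernels\<close>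

definition fun_scale :: "complex \<Rightarrow> ('a \<Rightarrow> complex) \<Rightarrow> 'a \<Rightarrow> complex" where
  "fun_scale c f = (\<lambda>x. c * f x)"

lemma vector_space_fun_scale: "vector_space fun_scale"
  by unfold_locales (auto simp: fun_scale_def algebra_simps fun_eq_iff)

text \<open>The left regular representation; the inverse makes it a left action. The value 0 off the
  carrier keeps the result among the functions supported on the group, a finite-dimensional
  space.\<close>

definition translate :: "('a, 'b) monoid_scheme \<Rightarrow> 'a \<Rightarrow> ('a \<Rightarrow> complex) \<Rightarrow> 'a \<Rightarrow> complex" where
  "translate G g f = (\<lambda>x. if x \<in> carrier G then f (inv\<^bsub>G\<^esub> g \<otimes>\<^bsub>G\<^esub> x) else 0)"

lemma (in group) linear_action_translate:
  assumes fin: "finite (carrier G)"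
  shows "linear_action G fun_scale (translate G) {f. \<forall>x. x \<notin> carrier G \<longrightarrow> f x = 0}"
proof -
  interpret F: vector_space "fun_scale :: complex \<Rightarrow> ('a \<Rightarrow> complex) \<Rightarrow> 'a \<Rightarrow> complex"
    by (rule vector_space_fun_scale)
  show ?thesis
  proof unfold_locales
    let ?V = "{f :: 'a \<Rightarrow> complex. \<forall>x. x \<notin> carrier G \<longrightarrow> f x = 0}"
    show "F.subspace ?V" by (rule F.subspaceI) (auto simp: fun_scale_def)
    \<comment> \<open>The point masses span the functions supported on the group.\<close>
    let ?\<delta> = "\<lambda>a x. if x = a then 1 else 0 :: complex"
    have "f \<in> F.span (?\<delta> ` carrier G)" if f: "f \<in> ?V" for f
    proof -
      have "f x = (\<Sum>a\<in>carrier G. f a * ?\<delta> a x)" for x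
      proof -
        have "(\<Sum>a\<in>carrier G. f a * ?\<delta> a x) = (\<Sum>a\<in>carrier G. if x = a then f a else 0)"
          by (intro sum.cong) auto
        then show ?thesis using f fin by simp
      qed
      moreover have "(\<Sum>a\<in>A. fun_scale (f a) (?\<delta> a)) x = (\<Sum>a\<in>A. f a * ?\<delta> a x)" for A x
        by (induction A rule: infinite_finite_induct) (auto simp: fun_scale_def)
      ultimately have "f = (\<Sum>a\<in>carrier G. fun_scale (f a) (?\<delta> a))" by (intro ext) metis
      also have "\<dots> \<in> F.span (?\<delta> ` carrier G)"
        by (intro F.span_sum F.span_scale F.span_base) auto
      finally show ?thesis .
    qed
    then show "\<exists>T. finite T \<and> ?V \<subseteq> F.span T" using fin by (intro exI[of _ "?\<delta> ` carrier G"]) auto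
  qed (auto simp: translate_def fun_scale_def fun_eq_iff inv_mult_group m_assoc)
qed

text \<open>In the regular representation the indicator function of \<open>N\<close> is fixed by
  \<open>N\<close> but moved by every element of \<open>K\<close> outside \<open>N\<close>.
  Consequently normal subgroups are determined by the irreducible representations that they lie in
  the kernel of.\<close>

lemma (in group) exists_irr_rep_separating:
  assumes fin: "finite (carrier G)" and N: "N \<lhd> G" and K: "K \<lhd> G" and KN: "\<not> K \<subseteq> N"
  shows "\<exists>n \<rho>. irr_rep G n \<rho> \<and> N \<subseteq> rep_ker G n \<rho> \<and> \<not> K \<subseteq> rep_ker G n \<rho>"
proof -
  interpret A: linear_action G fun_scale "translate G" "{f. \<forall>x. x \<notin> carrier G \<longrightarrow> f x = 0}"
    using fin by (rule linear_action_translate)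
  have Nsub: "subgroup N G" using N by (rule normal_imp_subgroup)
  define v :: "'a \<Rightarrow> complex" where "v = (\<lambda>x. if x \<in> N then 1 else 0)"
  have "v \<in> {f. \<forall>x. x \<notin> carrier G \<longrightarrow> f x = 0}"
    using subgroup.mem_carrier[OF Nsub] by (auto simp: v_def)
  moreover have "translate G x v = v" if x: "x \<in> N" for x
  proof
    fix y
    have xG: "x \<in> carrier G" using subgroup.mem_carrier[OF Nsub x] .
    have "inv x \<otimes> y \<in> N \<longleftrightarrow> y \<in> N" if y: "y \<in> carrier G"
    proof
      assume "inv x \<otimes> y \<in> N"
      then have "x \<otimes> (inv x \<otimes> y) \<in> N" using subgroup.m_closed[OF Nsub x] by blast
      then show "y \<in> N" using xG y by (simp add: m_assoc[symmetric])
    qed (use subgroup.m_closed[OF Nsub subgroup.m_inv_closed[OF Nsub x]] in blast)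
    then show "translate G x v y = v y"
      using subgroup.mem_carrier[OF Nsub] by (auto simp: translate_def v_def)
  qed
  moreover obtain k where k: "k \<in> K" "k \<notin> N" using KN by blast
  have kG: "k \<in> carrier G" using subgroup.mem_carrier[OF normal_imp_subgroup[OF K] k(1)] .
  \<comment> \<open>At \<open>k\<close> the translate takes the value \<open>v \<one> = 1\<close>,
    while \<open>v k = 0\<close>.\<close>
  have "translate G k v k \<noteq> v k"
    using kG k(2) subgroup.one_closed[OF Nsub] by (simp add: translate_def v_def)
  then have "translate G k v \<noteq> v" by metis
  ultimately show ?thesis by (rule A.exists_irr_rep_kernel[OF fin N K _ _ k(1)])
qed

text \<open>The entries of 1 by 1 matrices commute, so commutators map to 1. It is applied in
  contrapositive form, to conclude that a representation nontrivial on \<open>G'\<close> is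
  nonlinear.\<close>

lemma (in group) linear_rep_derived_trivial:
  assumes \<sigma>: "is_rep G 1 \<sigma>"
  shows "derived G (carrier G) \<subseteq> rep_ker G 1 \<sigma>"
proof -
  note S = is_repD[OF \<sigma>]
  let ?c = "\<lambda>g. \<sigma> g $$ (0, 0)"
  have mult: "?c (g \<otimes> h) = ?c g * ?c h" if "g \<in> carrier G" "h \<in> carrier G" for g h
    using S(1)[OF that(1)] S(1)[OF that(2)] S(2)[OF that] by (simp add: scalar_prod_def)
  have one: "?c \<one> = 1" using S(3) by simp
  have "\<sigma> (x \<otimes> y \<otimes> inv x \<otimes> inv y) = 1\<^sub>m 1" if xy: "x \<in> carrier G" "y \<in> carrier G" for x y
  proof (rule eq_matI)
    have "?c (x \<otimes> y \<otimes> inv x \<otimes> inv y) = (?c x * ?c (inv x)) * (?c y * ?c (inv y))"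
      using xy by (simp add: mult)
    also have "\<dots> = 1"
      using mult[of x "inv x"] mult[of y "inv y"] one xy by simp
    finally show "\<sigma> (x \<otimes> y \<otimes> inv x \<otimes> inv y) $$ (i, j) = 1\<^sub>m 1 $$ (i, j)"
      if "i < dim_row (1\<^sub>m 1 :: complex mat)" "j < dim_col (1\<^sub>m 1 :: complex mat)" for i j
      using that by simp
  qed (use S(1)[of "x \<otimes> y \<otimes> inv x \<otimes> inv y"] xy in auto)
  then have "derived_set G (carrier G) \<subseteq> rep_ker G 1 \<sigma>" by (auto simp: rep_ker_def)
  then show ?thesis
    unfolding derived_def
    by (rule generate_subgroup_incl[OF _ normal_imp_subgroup[OF rep_ker_normal[OF \<sigma>]]])
qed

section \<open>Kernels of nonlinear irreducible characters\<close>

definition nonlinear_kernels :: "('a, 'b) monoid_scheme \<Rightarrow> 'a set set" where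
  "nonlinear_kernels G = {rep_ker G n \<rho> | n \<rho>. irr_rep G n \<rho> \<and> n > 1}"

lemma (in group) nonlinear_kernels_eq:
  assumes fin: "finite (carrier G)"
  shows "{char_ker G \<chi> | \<chi>. \<chi> \<in> Irr G \<and> Re (\<chi> \<one>) > 1} = nonlinear_kernels G"
proof -
  \<comment> \<open>The value at the identity is the trace of the identity matrix, so its real part
    is the degree \<open>n\<close>.\<close>
  have deg: "Re ((\<lambda>g\<in>carrier G. mat_trace (\<rho> g)) \<one>) > 1 \<longleftrightarrow> n > 1" if "is_rep G n \<rho>" for n \<rho>
    using is_repD(3)[OF that] by (simp add: mat_trace_def)
  have rep: "is_rep G n \<rho>" if "irr_rep G n \<rho>" for n \<rho> using that by (simp add: irr_rep_def)
  show ?thesis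
  proof (intro equalityI subsetI)
    fix K assume "K \<in> {char_ker G \<chi> | \<chi>. \<chi> \<in> Irr G \<and> Re (\<chi> \<one>) > 1}"
    then obtain n \<rho> where "irr_rep G n \<rho>" "Re ((\<lambda>g\<in>carrier G. mat_trace (\<rho> g)) \<one>) > 1"
      "K = char_ker G (\<lambda>g\<in>carrier G. mat_trace (\<rho> g))"
      unfolding Irr_def by blast
    then show "K \<in> nonlinear_kernels G"
      unfolding nonlinear_kernels_def using deg[OF rep] char_ker_rep[OF fin rep] by blast
  next
    fix K assume "K \<in> nonlinear_kernels G"
    then obtain n \<rho> where "irr_rep G n \<rho>" "n > 1" "K = rep_ker G n \<rho>"
      unfolding nonlinear_kernels_def by blast
    then show "K \<in> {char_ker G \<chi> | \<chi>. \<chi> \<in> Irr G \<and> Re (\<chi> \<one>) > 1}"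
      unfolding Irr_def using deg[OF rep] char_ker_rep[OF fin rep] by blast
  qed
qed

lemma (in group) nonlinear_kernel_normal:
  assumes "K \<in> nonlinear_kernels G"
  shows "K \<lhd> G" "\<not> derived G (carrier G) \<subseteq> K"
proof -
  obtain n \<rho> where K: "irr_rep G n \<rho>" "n > 1" "K = rep_ker G n \<rho>"
    using assms unfolding nonlinear_kernels_def by blast
  show "K \<lhd> G" using K rep_ker_normal by (simp add: irr_rep_def)
  show "\<not> derived G (carrier G) \<subseteq> K" using irr_rep_derived_trivial_dim[OF K(1)] K(2,3) by auto
qed

text \<open>Multiplying by a linear character shows that an element in the kernels of all nonlinear
  characters of \<open>G/N\<close> is in the kernels of the linear ones too. So \<open>N\<close> is the intersection of the
  kernels of nonlinear characters above it, and in a chain this intersection is the smallest of them.\<close>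

lemma (in group) normal_in_nonlinear_kernels:
  assumes fin: "finite (carrier G)"
    and chain: "\<And>K1 K2. K1 \<in> nonlinear_kernels G \<Longrightarrow> K2 \<in> nonlinear_kernels G \<Longrightarrow> K1 \<subseteq> K2 \<or> K2 \<subseteq> K1"
    and N: "N \<lhd> G" and D: "\<not> derived G (carrier G) \<subseteq> N"
  shows "N \<in> nonlinear_kernels G"
proof -
  let ?S = "{K \<in> nonlinear_kernels G. N \<subseteq> K}"
  have "?S \<subseteq> Pow (carrier G)" by (auto simp: nonlinear_kernels_def rep_ker_def)
  then have "finite ?S" using fin finite_subset by blast
  have "?S \<noteq> {}"
  proof -
    obtain n \<rho> where \<rho>: "irr_rep G n \<rho>" "N \<subseteq> rep_ker G n \<rho>" "\<not> derived G (carrier G) \<subseteq> rep_ker G n \<rho>"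
      using exists_irr_rep_separating[OF fin N derived_self_is_normal D] by blast
    then have "n \<noteq> 1" using linear_rep_derived_trivial[of \<rho>] by (auto simp: irr_rep_def)
    then have "n > 1" using \<rho>(1) by (simp add: irr_rep_def)
    then show ?thesis using \<rho> unfolding nonlinear_kernels_def by blast
  qed
  from finite_has_minimal[OF \<open>finite ?S\<close> this] obtain K where K: "K \<in> ?S" "\<forall>L\<in>?S. L \<subseteq> K \<longrightarrow> K = L"
    by (elim bexE)
  \<comment> \<open>In a chain a minimal element is the least one.\<close>
  have least: "K \<subseteq> L" if "L \<in> ?S" for L using chain[of K L] K that by blast
  have "K \<subseteq> N"
  proof (rule ccontr)
    assume "\<not> K \<subseteq> N"
    moreover have "K \<lhd> G" using nonlinear_kernel_normal(1) K(1) by blast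
    ultimately obtain m \<sigma> where \<sigma>: "irr_rep G m \<sigma>" "N \<subseteq> rep_ker G m \<sigma>" "\<not> K \<subseteq> rep_ker G m \<sigma>"
      using exists_irr_rep_separating[OF fin N] by blast
    \<comment> \<open>A nonlinear \<open>\<sigma>\<close> would have its kernel among the members of
      \<open>?S\<close>, all of which contain \<open>K\<close>.\<close>
    have "\<not> m > 1" using \<sigma> least unfolding nonlinear_kernels_def by blast
    moreover have "m > 0" using \<sigma>(1) by (simp add: irr_rep_def)
    ultimately have "m = 1" by simp
    then have lin: "is_rep G 1 \<sigma>" using \<sigma>(1) by (simp add: irr_rep_def)
    obtain n \<rho> where \<rho>: "irr_rep G n \<rho>" "n > 1" "K = rep_ker G n \<rho>"
      using K(1) unfolding nonlinear_kernels_def by blast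
    \<comment> \<open>The twist of \<open>\<rho>\<close> by \<open>\<sigma>\<close> is again
      nonlinear and trivial on \<open>N\<close>, so its kernel contains the least member
      \<open>K\<close>.\<close>
    let ?\<tau> = "\<lambda>g. \<sigma> g $$ (0, 0) \<cdot>\<^sub>m \<rho> g"
    have one: "1 \<cdot>\<^sub>m 1\<^sub>m n = (1\<^sub>m n :: complex mat)" by (intro eq_matI) auto
    have "N \<subseteq> rep_ker G n ?\<tau>"
    proof
      fix x assume "x \<in> N"
      then have "x \<in> rep_ker G m \<sigma>" "x \<in> rep_ker G n \<rho>" using \<sigma>(2) K(1) \<rho>(3) by auto
      then show "x \<in> rep_ker G n ?\<tau>" using \<open>m = 1\<close> one by (simp add: rep_ker_def)
    qed
    then have "rep_ker G n ?\<tau> \<in> ?S"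
      using irr_rep_twist[OF \<rho>(1) lin] \<rho>(2) unfolding nonlinear_kernels_def by blast
    then have KT: "K \<subseteq> rep_ker G n ?\<tau>" by (rule least)
    \<comment> \<open>On \<open>K\<close> both \<open>\<rho>\<close> and its twist are the identity,
      so the scalar by which they differ is 1.\<close>
    have "x \<in> rep_ker G m \<sigma>" if x: "x \<in> K" for x
    proof -
      have xG: "x \<in> carrier G" and "\<rho> x = 1\<^sub>m n" "?\<tau> x = 1\<^sub>m n"
        using x KT \<rho>(3) by (auto simp: rep_ker_def)
      then have "(\<sigma> x $$ (0, 0) \<cdot>\<^sub>m 1\<^sub>m n) $$ (0, 0) = (1\<^sub>m n :: complex mat) $$ (0, 0)" by simp
      then have "\<sigma> x $$ (0, 0) = 1" using \<rho>(2) by simp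
      then have "\<sigma> x = 1\<^sub>m 1" using is_repD(1)[OF lin xG] by (intro eq_matI) auto
      then show ?thesis using xG \<open>m = 1\<close> by (simp add: rep_ker_def)
    qed
    then show False using \<sigma>(3) by blast
  qed
  then show ?thesis using K(1) by auto
qed

theorem theorem1p2:
  fixes G :: "('a, 'b) monoid_scheme"
  assumes "group G" and "finite (carrier G)"
  shows "(\<forall>K1\<in>{char_ker G \<chi> | \<chi>. \<chi> \<in> Irr G \<and> Re (\<chi> \<one>\<^bsub>G\<^esub>) > 1}.
           \<forall>K2\<in>{char_ker G \<chi> | \<chi>. \<chi> \<in> Irr G \<and> Re (\<chi> \<one>\<^bsub>G\<^esub>) > 1}.
             K1 \<subseteq> K2 \<or> K2 \<subseteq> K1)
     \<longleftrightarrow>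
     (\<forall>M. M \<lhd> G \<and> M \<subset> derived G (carrier G) \<longrightarrow>
        (\<not> chief_factor G (derived G (carrier G)) M \<and>
           card {N. minimal_normal (G Mod M) N} = 1)
      \<or> (chief_factor G (derived G (carrier G)) M \<and>
           card {N. minimal_normal (G Mod M) N} \<le> 2))"
proof -
  interpret group G by (rule assms(1))
  have "(\<forall>K1\<in>nonlinear_kernels G. \<forall>K2\<in>nonlinear_kernels G. K1 \<subseteq> K2 \<or> K2 \<subseteq> K1)
      \<longleftrightarrow> normals_avoiding_derived_chain G"
  proof
    assume "\<forall>K1\<in>nonlinear_kernels G. \<forall>K2\<in>nonlinear_kernels G. K1 \<subseteq> K2 \<or> K2 \<subseteq> K1"
    then show "normals_avoiding_derived_chain G"
      unfolding normals_avoiding_derived_chain_def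
      using normal_in_nonlinear_kernels[OF assms(2)] by meson
  next
    assume "normals_avoiding_derived_chain G"
    then show "\<forall>K1\<in>nonlinear_kernels G. \<forall>K2\<in>nonlinear_kernels G. K1 \<subseteq> K2 \<or> K2 \<subseteq> K1"
      unfolding normals_avoiding_derived_chain_def using nonlinear_kernel_normal by meson
  qed
  then show ?thesis
    unfolding nonlinear_kernels_eq[OF assms(2)] normals_chain_iff_chief_factors[OF assms(2)] .
qed

end
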